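(* Let $\nu$ be a positive integer, and let $N_k = n_k+n_{k+1}+\dots +n_{\nu}$, for $k=1,2,\dots, \nu$. Then, for non-negative integers $L,M$, \begin{align*} \sum_{\substack{m,n_1,n_2,\dots,n_\nu\geq 0,\\ L+m\equiv N_1+N_2+\dots +N_\nu\text{ (mod 2)}}} &q^{m^2+3(N_1^2+N_2^2+\dots+N_\nu^2)}{L+M-N_1\brack L}_{q^6} {3n_\nu \brack m}_{q^2}\\ &\times{2n_\nu + \frac{L-m-N_1-N_2-\dots-N_\nu}{2}\brack 2n_\nu}_{q^6} \prod_{j=1}^{\nu-1}{L-\sum_{l=1}^{j} N_l+n_j \brack n_j}_{q^6}\\ & = \sum_{j=-\infty}^\infty q^{3(\nu+1)j^2+2j}\, \mathcal{T}\left(L,M;\,(\nu+1)j,\,j;\,q^6\right). \end{align*}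
   Context: Here $|q|<1$, $(a;q)_n=(1-a)(1-aq)\cdots(1-aq^{n-1})$, and ${m+n \brack m}_q = \frac{(q;q)_{m+n}}{(q;q)_m(q;q)_n}$ for $m,n\geq 0$ and $0$ otherwise. The refined $q$-trinomial coefficient is \[\mathcal{T}(L,M;\,a,b;\,q) := \sum_{\substack{n\geq0, \\ L-a\equiv n \text{ (mod 2)}}} q^{\frac{n^2}{2}} {M\brack n}_q {M+b+\frac{L-a-n}{2} \brack M+b}_q {M-b +\frac{L+a-n}{2}\brack M-b}_q.\] *)

theory Defs
  imports "HOL-Analysis.Analysis" "HOL-Number_Theory.Cong"
begin

definition qpoch :: "complex \<Rightarrow> complex \<Rightarrow> nat \<Rightarrow> complex" where
  "qpoch a q n = (\<Prod>k<n. 1 - a * q ^ k)"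

(* qbinom q A m is the q-binomial coefficient with top entry A and bottom entry m, in base q.
   With A = m + n, the condition m, n >= 0 reads 0 <= m and 0 <= A - m.  The entries are
   integers because negative tops and bottoms do occur; the coefficient is then 0. *)
definition qbinom :: "complex \<Rightarrow> int \<Rightarrow> int \<Rightarrow> complex" where
  "qbinom q A m =
     (if 0 \<le> m \<and> 0 \<le> A - m
      then qpoch q q (nat A) / (qpoch q q (nat m) * qpoch q q (nat (A - m)))
      else 0)"

(* The refined q-trinomial coefficient T(L, M; a, b; q) contains q^(n^2/2).  To avoid choosing
   a branch of the square root, the first argument is s = q^(1/2), so that the base is
   q = s^2 and q^(n^2/2) = s^(n^2).  In particular T(L, M; a, b; q^6), in which (q^6)^(n^2/2)
   stands for q^(3 n^2), is refined_qtrinomial (q^3) L M a b.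
   The divisions by 2 are exact by the parity condition on n. *)
definition refined_qtrinomial :: "complex \<Rightarrow> int \<Rightarrow> int \<Rightarrow> int \<Rightarrow> int \<Rightarrow> complex" where
  "refined_qtrinomial s L M a b =
     (\<Sum>\<^sub>\<infinity>n\<in>{n::nat. [L - a = int n] (mod 2)}.
        s ^ (n\<^sup>2) * qbinom (s\<^sup>2) M (int n)
        * qbinom (s\<^sup>2) (M + b + (L - a - int n) div 2) (M + b)
        * qbinom (s\<^sup>2) (M - b + (L + a - int n) div 2) (M - b))"

definition tail_sum :: "nat \<Rightarrow> (nat \<Rightarrow> nat) \<Rightarrow> nat \<Rightarrow> nat" where
  "tail_sum \<nu> n k = (\<Sum>i=k..\<nu>. n i)"

(* The infinite sum in the trinomial has only finitely many nonzero terms. *)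
lemma refined_qtrinomial_finite:
  assumes "M \<ge> 0"
  shows "refined_qtrinomial s L M a b =
     (\<Sum>n\<in>{n. n \<le> nat M \<and> [L - a = int n] (mod 2)}.
        s ^ (n\<^sup>2) * qbinom (s\<^sup>2) M (int n)
        * qbinom (s\<^sup>2) (M + b + (L - a - int n) div 2) (M + b)
        * qbinom (s\<^sup>2) (M - b + (L + a - int n) div 2) (M - b))"
    (is "_ = sum ?f ?A")
proof -
  have "refined_qtrinomial s L M a b = infsum ?f ?A"
    unfolding refined_qtrinomial_def
    by (rule infsum_cong_neutral) (use assms in \<open>auto simp: qbinom_def\<close>)
  also have "\<dots> = sum ?f ?A"
    by (rule infsum_finite) simp
  finally show ?thesis .
qed

end

theory Submission
  imports Defs
begin

text \<open>The identity is obtained by iterating the transformation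
  \<open>\<Sum>i. q^(i^2/2) [L+M-i; L] T(L-i, i; a, b) = q^(b^2/2) T(L, M; a+b, b)\<close> for \<open>a, b\<close> of the same
  sign, applied to the term \<open>j\<close> with \<open>a = \<nu> j\<close>, \<open>b = j\<close>, with \<open>i\<close> in the role of \<open>N_1\<close>.
  The iteration starts from a seed (\<open>\<nu> = 0\<close>), in which the \<open>q\<close>-Pfaff--Saalschuetz sum turns
  \<open>\<Sum>j. q^(3j^2+2j) T(L, M; j, j; q^6)\<close> into coefficients of a product of three
  \<open>q^6\<close>-shifted factorials, and these multiply to \<open>(-xq; q^2)_(3M)\<close>.

  For the transformation, two applications of the \<open>q\<close>-Pascal rules give a four-term recurrence in
  \<open>(L, a, b)\<close> satisfied by both sides, whose only terms of maximal \<open>L\<close> are \<open>(a, b)\<close> and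
  \<open>(a+1, b-1)\<close>. Hence one may lower \<open>b\<close> to \<open>0\<close>, where the identity holds termwise by
  \<open>q\<close>-Pfaff--Saalschuetz.\<close>

section \<open>Gaussian binomial coefficients\<close>

text \<open>The shape of the formula has its origin in the seed. The \<open>3 * M\<close> odd powers
  q^(2k+1) fall by k mod 3 into q^(3(2k+1)) times q^(-2), 1 and q^2, which gives three binomials in
  base q^6. If u and v index the two outer ones, then j = v - u: the weight q^(2v-2u) is the linear
  term 2j of the exponent, while 3j^2 comes from the seed and again from each transformation. After
  \<nu> transformations the last i is n_\<nu> and stands where M stood in the seed, hence the
  entries 3n_\<nu> and 2n_\<nu>. The obstacle in the transformation is that i occurs in the weight
  and in both arguments of the inner trinomial. A recurrence for trinomials that also lowers M
  becomes, at M = i, a relation with terms in i - 1. Summation by parts against [L+M-i; L] trades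
  these for the same sum at L - 1, so that the left side gets a closed recurrence in (L, a, b) at
  fixed M, which can be compared with the one for the right side.\<close>

lemma sum_int_shift:
  fixes f :: "int \<Rightarrow> 'a::comm_monoid_add"
  assumes "0 \<le> K" "f (-1) = 0" "f K = 0"
  shows "(\<Sum>c\<in>{0..K}. f (c - 1)) = (\<Sum>c\<in>{0..K}. f c)"
  by (rule sum.reindex_bij_witness_not_neutral[where S' = "{0}" and T' = "{K}"
        and i = "\<lambda>c. c + 1" and j = "\<lambda>c. c - 1"]) (use assms in auto)

lemma qbinom_eq_0: "m < 0 \<or> A < m \<Longrightarrow> qbinom q A m = 0"
  by (auto simp: qbinom_def)

lemma qbinom_sym: "qbinom q A (A - m) = qbinom q A m"
  by (auto simp: qbinom_def mult.commute)

lemma qpoch_Suc: "qpoch a q (Suc n) = qpoch a q n * (1 - a * q ^ n)"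
  by (simp add: qpoch_def mult.commute)

lemma qpoch_0 [simp]: "qpoch a q 0 = 1"
  by (simp add: qpoch_def)

lemma qpoch_neq_0:
  assumes "norm q < 1"
  shows "qpoch q q n \<noteq> 0"
proof -
  have "1 - q * q ^ k \<noteq> 0" for k
  proof
    assume "1 - q * q ^ k = 0"
    hence "norm (q ^ Suc k) = 1" by (metis norm_one power_Suc right_minus_eq)
    moreover have "norm (q ^ Suc k) < 1"
      using assms by (simp add: norm_power power_less_one_iff del: power_Suc)
    ultimately show False by simp
  qed
  thus ?thesis by (auto simp: qpoch_def)
qed

lemma qbinom_nat:
  "m \<le> n \<Longrightarrow> qbinom q (int n) (int m) = qpoch q q n / (qpoch q q m * qpoch q q (n - m))"
  by (simp add: qbinom_def nat_diff_distrib)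

lemma qbinom_0 [simp]: "norm q < 1 \<Longrightarrow> 0 \<le> A \<Longrightarrow> qbinom q A 0 = 1"
  by (simp add: qbinom_def qpoch_neq_0)

lemma qbinom_self [simp]: "norm q < 1 \<Longrightarrow> 0 \<le> A \<Longrightarrow> qbinom q A A = 1"
  by (simp add: qbinom_def qpoch_neq_0)

lemma qbinom_pascal_nat:
  assumes "norm q < 1"
  shows "qbinom q (int (Suc n)) (int (Suc m))
    = qbinom q (int n) (int (Suc m)) + q ^ (n - m) * qbinom q (int n) (int m)"
proof -
  consider "n < m" | "n = m" | "m < n" by linarith
  thus ?thesis
  proof cases
    case 1
    thus ?thesis by (simp add: qbinom_eq_0)
  next
    case 2
    thus ?thesis using assms by (simp add: qbinom_eq_0 del: of_nat_Suc)
  next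
    case 3
    then obtain k where k: "n = m + Suc k" using less_imp_Suc_add by auto
    have nz: "qpoch q q j \<noteq> 0" for j using qpoch_neq_0[OF assms] .
    have nz1: "1 - q * q ^ j \<noteq> 0" for j using nz[of "Suc j"] by (auto simp: qpoch_Suc)
    have "qbinom q (int (Suc n)) (int (Suc m))
        = qpoch q q n * (1 - q ^ m * q * q ^ k * q) / (qpoch q q m * (1 - q * q ^ m) * (qpoch q q k * (1 - q * q ^ k)))"
      using qbinom_nat[of "Suc m" "Suc n" q] k by (simp add: qpoch_Suc power_add mult_ac)
    also have "\<dots> = qpoch q q n / (qpoch q q m * (1 - q * q ^ m) * qpoch q q k)
        + (q * q ^ k) * (qpoch q q n / (qpoch q q m * (qpoch q q k * (1 - q * q ^ k))))"
    proof -
      have "P * (1 - x * y) / (Qm * (1 - x) * (Qk * (1 - y)))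
          = P / (Qm * (1 - x) * Qk) + y * (P / (Qm * (Qk * (1 - y))))"
        if "Qm \<noteq> 0" "Qk \<noteq> 0" "1 - x \<noteq> 0" "1 - y \<noteq> 0" for P Qm Qk x y :: complex
      proof -
        have "P / (Qm * (1 - x) * Qk) = P * (1 - y) / (Qm * (1 - x) * (Qk * (1 - y)))"
             "y * (P / (Qm * (Qk * (1 - y)))) = y * P * (1 - x) / (Qm * (1 - x) * (Qk * (1 - y)))"
          using that by (simp_all add: mult_ac)
        moreover have "P * (1 - x * y) = P * (1 - y) + y * P * (1 - x)"
          by (simp add: algebra_simps)
        ultimately show ?thesis by (simp only: add_divide_distrib)
      qed
      from this[OF nz[of m] nz[of k] nz1[of m] nz1[of k], of "qpoch q q n"]
      show ?thesis by (simp add: mult_ac)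
    qed
    also have "qpoch q q n / (qpoch q q m * (1 - q * q ^ m) * qpoch q q k) = qbinom q (int n) (int (Suc m))"
      using qbinom_nat[of "Suc m" n q] k by (simp add: qpoch_Suc)
    also have "qpoch q q n / (qpoch q q m * (qpoch q q k * (1 - q * q ^ k))) = qbinom q (int n) (int m)"
      using qbinom_nat[of m n q] k by (simp add: qpoch_Suc)
    finally show ?thesis using k by simp
  qed
qed

text \<open>At \<open>A = m = 0\<close> the rule fails: the left side is 1, but both coefficients on
  the right have top -1 and vanish. Where later arguments could hit this case, the rule is applied
  next to a companion factor that is 0 there.\<close>

lemma qbinom_pascal:
  assumes "norm q < 1" "A \<noteq> 0 \<or> m \<noteq> 0"
  shows "qbinom q A m = qbinom q (A - 1) m + q powi (A - m) * qbinom q (A - 1) (m - 1)"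
proof -
  consider "m < 0" | "A < m" | "m = 0" "0 < A" | "0 < m" "m \<le> A" using assms(2) by linarith
  thus ?thesis
  proof cases
    case 4
    then obtain n k where nk: "A = int (Suc n)" "m = int (Suc k)"
      by (metis gr0_conv_Suc less_le_trans zero_less_imp_eq_int)
    with 4 have "k \<le> n" by simp
    hence "q powi (A - m) = q ^ (n - k)"
      by (simp add: nk of_nat_diff [symmetric] del: of_nat_diff)
    thus ?thesis using qbinom_pascal_nat[OF assms(1), of n k] by (simp add: nk)
  qed (use assms in \<open>auto simp: qbinom_eq_0\<close>)
qed

lemma qbinom_pascal':
  assumes "norm q < 1" "A \<noteq> 0 \<or> m \<noteq> 0"
  shows "qbinom q A m = q powi m * qbinom q (A - 1) m + qbinom q (A - 1) (m - 1)"
proof -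
  have "qbinom q A (A - m) = qbinom q (A - 1) (A - m) + q powi (A - (A - m)) * qbinom q (A - 1) (A - m - 1)"
    by (rule qbinom_pascal) (use assms in auto)
  moreover have "A - m = A - 1 - (m - 1)" "A - m - 1 = A - 1 - m" by simp_all
  ultimately show ?thesis by (metis add.commute diff_diff_eq2 qbinom_sym add_diff_cancel_left')
qed

text \<open>Both sides are the q-multinomial coefficient with parts \<open>k\<close>,
  \<open>m - k\<close>, \<open>A - m\<close>.\<close>

lemma qbinom_trinomial:
  assumes "norm q < 1"
  shows "qbinom q A m * qbinom q m k = qbinom q A k * qbinom q (A - k) (m - k)"
proof (cases "0 \<le> k \<and> k \<le> m \<and> m \<le> A")
  case True
  thus ?thesis using qpoch_neq_0[OF assms] by (simp add: qbinom_def)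
next
  case False
  thus ?thesis by (auto simp: qbinom_def)
qed

text \<open>This is the \<open>q\<close>-Pfaff--Saalschuetz sum. Both sides satisfy the same Pascal-type recurrence
  in \<open>(M1, R, S)\<close>.\<close>

lemma qbinom_saalschuetz:
  assumes s0: "s \<noteq> 0" and s1: "norm s < 1" and M1: "0 \<le> M1" and M2: "0 \<le> M2"
  shows "qbinom (s\<^sup>2) (M1 + S) R * qbinom (s\<^sup>2) (M2 + R) S
    = (\<Sum>k\<in>{0..S}. s powi (2 * ((S - k) * (R - k))) * qbinom (s\<^sup>2) (M1 + M2 + k) k
         * qbinom (s\<^sup>2) M1 (R - k) * qbinom (s\<^sup>2) M2 (S - k))"
proof -
  let ?b = "qbinom (s\<^sup>2)"
  have n2: "norm (s\<^sup>2) < 1" using s1 by (simp add: norm_power power_less_one_iff)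
  have sq: "(s\<^sup>2) powi e = s powi (2 * e)" for e
    by (simp add: power_int_mult)
  have pa: "s powi a * s powi b = s powi (a + b)" for a b
    using s0 by (simp add: power_int_add)
  define h where "h = (\<lambda>M1 R S. ?b (M1 + S) R * ?b (M2 + R) S)"
  define t where "t = (\<lambda>M1 R S k. s powi (2 * ((S - k) * (R - k))) * ?b (M1 + M2 + k) k
         * ?b M1 (R - k) * ?b M2 (S - k))"
  define g where "g = (\<lambda>M1 R S. \<Sum>k\<in>{0..S}. t M1 R S k)"
  have hrec: "h M R S = s powi (2 * (M + M2)) * h M (R - 1) (S - 1) + h (M - 1) R S
      + s powi (2 * (M + S - R)) * h (M - 1) (R - 1) S"
    if "1 \<le> M" "0 \<le> S" for M R S
  proof -
    have 1: "?b (M + S) R = ?b (M + S - 1) R + s powi (2 * (M + S - R)) * ?b (M + S - 1) (R - 1)"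
      using qbinom_pascal[OF n2, of "M + S" R] that by (auto simp: sq)
    have 2: "?b (M + S - 1) (R - 1) * ?b (M2 + R) S = ?b (M + S - 1) (R - 1) *
        (?b (M2 + R - 1) S + s powi (2 * (M2 + R - S)) * ?b (M2 + R - 1) (S - 1))"
    proof (cases "M2 + R = 0 \<and> S = 0")
      case True
      thus ?thesis using M2 by (simp add: qbinom_eq_0)
    next
      case False
      thus ?thesis using qbinom_pascal[OF n2, of "M2 + R" S] by (auto simp: sq)
    qed
    have e: "s powi (2 * (M + S - R)) * s powi (2 * (M2 + R - S)) = s powi (2 * (M + M2))"
      by (simp add: pa algebra_simps)
    have "h M R S = ?b (M + S - 1) R * ?b (M2 + R) S
        + s powi (2 * (M + S - R)) * (?b (M + S - 1) (R - 1) * ?b (M2 + R) S)"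
      unfolding h_def 1 by (simp add: algebra_simps)
    also have "\<dots> = ?b (M + S - 1) R * ?b (M2 + R) S
        + s powi (2 * (M + S - R)) * ?b (M + S - 1) (R - 1) * ?b (M2 + R - 1) S
        + (s powi (2 * (M + S - R)) * s powi (2 * (M2 + R - S))) * (?b (M + S - 1) (R - 1) * ?b (M2 + R - 1) (S - 1))"
      unfolding 2 by (simp add: algebra_simps)
    finally show ?thesis unfolding e h_def by (simp add: algebra_simps)
  qed
  have grec: "g M R S = s powi (2 * (M + M2)) * g M (R - 1) (S - 1) + g (M - 1) R S
      + s powi (2 * (M + S - R)) * g (M - 1) (R - 1) S"
    if "1 \<le> M" "0 \<le> S" for M R S
  proof -
    have "t M R S k = s powi (2 * (M + M2)) * t M (R - 1) (S - 1) (k - 1) + t (M - 1) R S k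
      + s powi (2 * (M + S - R)) * t (M - 1) (R - 1) S k" for k
    proof -
      have 1: "?b (M + M2 + k) k = ?b (M + M2 + k - 1) k + s powi (2 * (M + M2)) * ?b (M + M2 + k - 1) (k - 1)"
        using qbinom_pascal[OF n2, of "M + M2 + k" k] that M2 by (auto simp: sq)
      have 2: "?b M (R - k) = ?b (M - 1) (R - k) + s powi (2 * (M - R + k)) * ?b (M - 1) (R - k - 1)"
        using qbinom_pascal[OF n2, of "M" "R - k"] that by (auto simp: sq algebra_simps)
      have e: "s powi (2 * ((S - k) * (R - k))) * s powi (2 * (M - R + k))
          = s powi (2 * (M + S - R)) * s powi (2 * ((S - k) * (R - 1 - k)))"
        by (simp add: pa algebra_simps)
      have "t M R S k = s powi (2 * (M + M2)) * (s powi (2 * ((S - k) * (R - k))) * ?b (M + M2 + k - 1) (k - 1)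
           * ?b M (R - k) * ?b M2 (S - k)) + s powi (2 * ((S - k) * (R - k))) * ?b (M + M2 + k - 1) k
           * ?b M (R - k) * ?b M2 (S - k)"
        unfolding t_def 1 by (simp add: algebra_simps)
      also have "s powi (2 * ((S - k) * (R - k))) * ?b (M + M2 + k - 1) k
           * ?b M (R - k) * ?b M2 (S - k) = t (M - 1) R S k +
           (s powi (2 * ((S - k) * (R - k))) * s powi (2 * (M - R + k))) * (?b (M + M2 + k - 1) k
           * ?b (M - 1) (R - k - 1) * ?b M2 (S - k))"
        unfolding t_def 2 by (simp add: algebra_simps)
      finally show ?thesis unfolding e t_def by (simp add: algebra_simps)
    qed
    hence "g M R S = s powi (2 * (M + M2)) * (\<Sum>k\<in>{0..S}. t M (R - 1) (S - 1) (k - 1)) + g (M - 1) R S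
      + s powi (2 * (M + S - R)) * g (M - 1) (R - 1) S"
      unfolding g_def by (simp add: sum.distrib sum_distrib_left)
    also have "(\<Sum>k\<in>{0..S}. t M (R - 1) (S - 1) (k - 1)) = g M (R - 1) (S - 1)"
      unfolding g_def
      by (rule sum.reindex_bij_witness_not_neutral[where S' = "{0}" and T' = "{}"
        and i = "\<lambda>c. c + 1" and j = "\<lambda>c. c - 1"]) (auto simp: t_def qbinom_eq_0)
    finally show ?thesis .
  qed
  have neg: "h M R S = g M R S" if "S < 0" for M R S
    using that by (simp add: h_def g_def qbinom_eq_0)
  have "h (int m) R S = g (int m) R S" for m R S
  proof (induction m arbitrary: R S)
    case 0
    show ?case
    proof (cases "0 \<le> R \<and> R \<le> S")
      case True
      \<comment> \<open>For \<open>M1 = 0\<close> only k = R survives, where the power of s is 1;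
        the remaining equality is \<open>qbinom_trinomial\<close>.\<close>
      have z: "?b 0 (R - k) = 0" if "k \<noteq> R" for k
        using that by (intro qbinom_eq_0) auto
      have "g 0 R S = (\<Sum>k\<in>{0..S}. if k = R then ?b (M2 + R) R * ?b M2 (S - R) else 0)"
        unfolding g_def t_def by (rule sum.cong) (use n2 M2 in \<open>auto simp: z\<close>)
      also have "\<dots> = ?b (M2 + R) R * ?b M2 (S - R)" using True by simp
      also have "\<dots> = h 0 R S" unfolding h_def
        using qbinom_trinomial[OF n2, of "M2 + R" S R] by (simp add: mult.commute)
      finally show ?thesis by simp
    next
      case False
      thus ?thesis unfolding h_def g_def t_def by (auto simp: qbinom_eq_0 intro!: sum.neutral[symmetric])
    qed
  next
    case (Suc m)
    \<comment> \<open>The recurrence has a term with the same first argument and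
      \<open>S - 1\<close>, so S needs an induction of its own. The offset starts it at S = -1,
      where both sides vanish.\<close>
    have "h (int (Suc m)) R (int j - 1) = g (int (Suc m)) R (int j - 1)" for j R
    proof (induction j arbitrary: R)
      case 0
      show ?case by (rule neg) simp
    next
      case (Suc j)
      have eqs: "int (Suc j) - 1 = int j" "int (Suc m) - 1 = int m" by simp_all
      have "h (int (Suc m)) R (int j) = g (int (Suc m)) R (int j)"
        using hrec[of "int (Suc m)" "int j" R] grec[of "int (Suc m)" "int j" R] Suc.IH[of "R - 1"]
        unfolding eqs \<open>\<And>R S. h (int m) R S = g (int m) R S\<close> by (simp del: of_nat_Suc)
      thus ?case unfolding eqs .
    qed
    from this[of R "nat (S + 1)"] neg[of S] show ?case by (cases "S < 0") auto
  qed
  from this[of "nat M1" R S] show ?thesis using M1 by (simp add: h_def g_def t_def)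
qed

section \<open>The transformation of refined trinomials\<close>

text \<open>The refined trinomial \<open>T(L, M; a, b)\<close> with the summation variable \<open>n\<close> of its definition
  replaced by \<open>c = (L - a - n) / 2\<close>, so that no parity condition remains. For \<open>a \<ge> 0\<close> every
  bound \<open>K \<ge> L\<close> gives the same sum.\<close>

definition trin_term :: "complex \<Rightarrow> int \<Rightarrow> int \<Rightarrow> int \<Rightarrow> int \<Rightarrow> int \<Rightarrow> complex" where
  "trin_term s L M a b c = s powi ((L - a - 2 * c)\<^sup>2) * qbinom (s\<^sup>2) M (L - a - 2 * c)
     * qbinom (s\<^sup>2) (M + b + c) (M + b) * qbinom (s\<^sup>2) (M - b + c + a) (M - b)"

definition trin :: "complex \<Rightarrow> int \<Rightarrow> int \<Rightarrow> int \<Rightarrow> int \<Rightarrow> int \<Rightarrow> complex" where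
  "trin s K L M a b = (\<Sum>c\<in>{0..K}. trin_term s L M a b c)"

text \<open>The left side of the transformation. One bound \<open>K\<close> serves all inner
  trinomials, so that relations between different values of L can be added over a common
  range.\<close>

definition trin_sum :: "complex \<Rightarrow> int \<Rightarrow> int \<Rightarrow> int \<Rightarrow> int \<Rightarrow> int \<Rightarrow> complex" where
  "trin_sum s K L M a b =
     (\<Sum>i\<in>{0..M}. s powi (i\<^sup>2) * qbinom (s\<^sup>2) (L + M - i) L * trin s K (L - i) i a b)"

lemma trin_term_eq_0:
  "c < 0 \<or> c + a < 0 \<or> L - a - 2 * c < 0 \<or> M < L - a - 2 * c \<or> M < b \<or> M + b < 0
    \<Longrightarrow> trin_term s L M a b c = 0"
  by (auto simp: trin_term_def qbinom_eq_0)

lemma trin_eq_0: "L < a \<or> M < b \<or> M < 0 \<Longrightarrow> trin s K L M a b = 0"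
  unfolding trin_def by (rule sum.neutral) (auto intro!: trin_term_eq_0)

text \<open>Here \<open>s\<close> is a square root of the base. It must not vanish because negative
  exponents occur and integer powers have to be additive.\<close>

locale half_base =
  fixes s :: complex
  assumes s0: "s \<noteq> 0" and s1: "norm s < 1"
begin

lemma norm_s2: "norm (s\<^sup>2) < 1"
  using s1 by (simp add: norm_power power_less_one_iff)

lemma s2_powi: "(s\<^sup>2) powi e = s powi (2 * e)"
  by (simp add: power_int_mult)

lemma powi_mult: "s powi a * s powi b = s powi (a + b)"
  using s0 by (simp add: power_int_add)

lemmas pascal = qbinom_pascal[OF norm_s2, unfolded s2_powi]
lemmas pascal' = qbinom_pascal'[OF norm_s2, unfolded s2_powi]

text \<open>This is the recurrence for the right side of the transformation, used at (a + b, b). It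
  holds summand by summand once c is lowered by 1 in the term (L - 1, a + 1): then all four summands
  have the same n = L - a - 2c, and one q-Pascal rule for each of the other two binomials
  suffices.\<close>

lemma trin_shift:
  assumes "1 \<le> b" "1 \<le> a" "0 \<le> M" "L \<le> K" "0 \<le> K"
  shows "trin s K L M a (b - 1) + s powi (2 * (M + b)) * trin s K (L - 1) M (a + 1) b
    = trin s K L M a b + s powi (2 * (M - b + 1)) * trin s K (L - 1) M (a - 1) (b - 1)"
proof -
  let ?b = "qbinom (s\<^sup>2)"
  have "trin_term s L M a (b - 1) c + s powi (2 * (M + b)) * trin_term s (L - 1) M (a + 1) b (c - 1)
    = trin_term s L M a b c + s powi (2 * (M - b + 1)) * trin_term s (L - 1) M (a - 1) (b - 1) c" for c
  proof -
    have 1: "?b (M + b + c) (M + b) = s powi (2 * (M + b)) * ?b (M + b + c - 1) (M + b) + ?b (M + b + c - 1) (M + b - 1)"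
      by (rule pascal') (use assms in auto)
    have 2: "?b (M + b + c - 1) (M + b - 1) * ?b (M - b + 1 + c + a) (M - b + 1) = ?b (M + b + c - 1) (M + b - 1) *
       (s powi (2 * (M - b + 1)) * ?b (M - b + c + a) (M - b + 1) + ?b (M - b + c + a) (M - b))"
    proof (cases "M - b + 1 + c + a = 0 \<and> M - b + 1 = 0")
      case True
      hence "c < 0" using assms by linarith
      thus ?thesis by (simp add: qbinom_eq_0)
    next
      case False
      thus ?thesis using pascal'[of "M - b + 1 + c + a" "M - b + 1"] by (auto simp: algebra_simps)
    qed
    define X where "X = s powi ((L - a - 2 * c)\<^sup>2) * ?b M (L - a - 2 * c)"
    have t: "trin_term s L M a (b - 1) c = X * (?b (M + b + c - 1) (M + b - 1) * ?b (M - b + 1 + c + a) (M - b + 1))"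
      "trin_term s (L - 1) M (a + 1) b (c - 1) = X * ?b (M + b + c - 1) (M + b) * ?b (M - b + c + a) (M - b)"
      "trin_term s L M a b c = X * ?b (M + b + c) (M + b) * ?b (M - b + c + a) (M - b)"
      "trin_term s (L - 1) M (a - 1) (b - 1) c = X * ?b (M + b + c - 1) (M + b - 1) * ?b (M - b + c + a) (M - b + 1)"
      by (simp_all add: trin_term_def X_def algebra_simps)
    show ?thesis unfolding t 1 2 by (simp add: algebra_simps)
  qed
  hence "trin s K L M a (b - 1) + s powi (2 * (M + b)) * (\<Sum>c\<in>{0..K}. trin_term s (L - 1) M (a + 1) b (c - 1))
    = trin s K L M a b + s powi (2 * (M - b + 1)) * trin s K (L - 1) M (a - 1) (b - 1)"
    unfolding trin_def sum_distrib_left sum.distrib[symmetric] by simp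
  also have "(\<Sum>c\<in>{0..K}. trin_term s (L - 1) M (a + 1) b (c - 1)) = trin s K (L - 1) M (a + 1) b"
    unfolding trin_def by (rule sum_int_shift) (use assms in \<open>auto intro!: trin_term_eq_0\<close>)
  finally show ?thesis .
qed

text \<open>The summands of the two sides agree only up to a shift: on the right they are
  \<open>A1 c + A2 c\<close>, on the left \<open>A1 c + A2 (c + 1)\<close>. The relation serves at M
  = i inside \<open>trin_sum\<close>, where its terms with M - 1 become terms with i - 1.\<close>

lemma trin_descent:
  assumes "1 \<le> b" "0 \<le> a" "0 \<le> M" "L \<le> K" "0 \<le> K"
  shows "s powi (2 * b - 1) * (trin s K L M (a + 1) (b - 1) - trin s K L (M - 1) (a + 1) b)
       - s powi (2 * M + 1) * trin s K (L - 1) M a (b - 1)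
    = trin s K L M a b - s powi (2 * (M + b)) * trin s K (L - 1) M (a + 1) b
       - trin s K L (M - 1) a (b - 1)"
proof -
  let ?b = "qbinom (s\<^sup>2)"
  \<comment> \<open>With n = L - a - 2c, \<open>A1\<close> is the part with [M-1; n-1] that splits
    off [M; n], and \<open>A2\<close> the first part of [M+b-1+c; M+b-1] under q-Pascal; the rest is
    the trinomial at (M - 1, b - 1).\<close>
  define A1 where "A1 = (\<lambda>c. s powi ((L - a - 2 * c)\<^sup>2 + 2 * (M - (L - a - 2 * c)))
     * ?b (M - 1) (L - a - 2 * c - 1) * ?b (M + b - 1 + c) (M + b - 1) * ?b (M - b + c + a) (M - b))"
  define A2 where "A2 = (\<lambda>c. s powi ((L - a - 2 * c)\<^sup>2 + 2 * (M + b - 1))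
     * ?b (M - 1) (L - a - 2 * c) * ?b (M + b - 1 + c - 1) (M + b - 1) * ?b (M - b + c + a) (M - b))"
  have A: "trin_term s L M a b c - s powi (2 * (M + b)) * trin_term s (L - 1) M (a + 1) b (c - 1)
      - trin_term s L (M - 1) a (b - 1) c = A1 c + A2 c" for c
  proof -
    define n where "n = L - a - 2 * c"
    define Y where "Y = ?b (M - b + c + a) (M - b)"
    have 1: "?b (M + b + c) (M + b) = s powi (2 * (M + b)) * ?b (M + b - 1 + c) (M + b) + ?b (M + b - 1 + c) (M + b - 1)"
      using pascal'[of "M + b + c" "M + b"] assms by (auto simp: algebra_simps)
    have 2: "Y * ?b M n = Y * (?b (M - 1) n + s powi (2 * (M - n)) * ?b (M - 1) (n - 1))"
    proof (cases "M = 0 \<and> n = 0")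
      case True
      thus ?thesis using assms by (simp add: Y_def qbinom_eq_0)
    next
      case False
      thus ?thesis using pascal[of M n] by auto
    qed
    have 3: "Y * ?b (M + b - 1 + c) (M + b - 1) = Y * (s powi (2 * (M + b - 1)) * ?b (M + b - 1 + c - 1) (M + b - 1)
         + ?b (M + b - 1 + c - 1) (M + b - 2))"
    proof (cases "M + b - 1 = 0")
      case True
      thus ?thesis using assms by (simp add: Y_def qbinom_eq_0)
    next
      case False
      thus ?thesis using pascal'[of "M + b - 1 + c" "M + b - 1"] by (auto simp: algebra_simps)
    qed
    have t: "trin_term s L M a b c = s powi n\<^sup>2 * ?b M n * ?b (M + b + c) (M + b) * Y"
      "trin_term s (L - 1) M (a + 1) b (c - 1) = s powi n\<^sup>2 * ?b M n * ?b (M + b - 1 + c) (M + b) * Y"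
      "trin_term s L (M - 1) a (b - 1) c = s powi n\<^sup>2 * ?b (M - 1) n * ?b (M + b - 1 + c - 1) (M + b - 2) * Y"
      "A1 c = s powi n\<^sup>2 * s powi (2 * (M - n)) * ?b (M - 1) (n - 1) * ?b (M + b - 1 + c) (M + b - 1) * Y"
      "A2 c = s powi n\<^sup>2 * s powi (2 * (M + b - 1)) * ?b (M - 1) n * ?b (M + b - 1 + c - 1) (M + b - 1) * Y"
      by (simp_all add: trin_term_def n_def Y_def A1_def A2_def powi_mult algebra_simps)
    have "trin_term s L M a b c - s powi (2 * (M + b)) * trin_term s (L - 1) M (a + 1) b (c - 1)
      = s powi n\<^sup>2 * ?b (M + b - 1 + c) (M + b - 1) * (Y * ?b M n)"
      unfolding t 1 by (simp add: algebra_simps)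
    also have "\<dots> = s powi n\<^sup>2 * ?b (M - 1) n * (Y * ?b (M + b - 1 + c) (M + b - 1)) + A1 c"
      unfolding 2 t by (simp add: algebra_simps)
    also have "\<dots> = trin_term s L (M - 1) a (b - 1) c + (A1 c + A2 c)"
      unfolding 3 t by (simp add: algebra_simps)
    finally show ?thesis by simp
  qed
  have B: "s powi (2 * b - 1) * (trin_term s L M (a + 1) (b - 1) c - trin_term s L (M - 1) (a + 1) b c)
       - s powi (2 * M + 1) * trin_term s (L - 1) M a (b - 1) c = A1 c + A2 (c + 1)" for c
  proof -
    \<comment> \<open>One less than the n of the right side, since the left terms have the opposite
      parity. The powers match by (n+1)^2 + 2(M-n-1) = n^2 + (2b-1) + 2(M-b) for \<open>A1\<close>
      and (n-1)^2 + 2(M+b-1) = n^2 + (2b-1) + 2(M-n) for \<open>A2\<close>; this is the source of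
      the odd exponent 2b - 1.\<close>
    define n where "n = L - a - 1 - 2 * c"
    define X where "X = ?b (M + b - 1 + c) (M + b - 1)"
    have 1: "X * ?b (M - b + 1 + c + a + 1) (M - b + 1) = X * (s powi (2 * (M - b + 1)) * ?b (M - b + 1 + c + a) (M - b + 1)
         + ?b (M - b + 1 + c + a) (M - b))"
    proof (cases "M - b + 1 = 0 \<and> c + a + 1 = 0")
      case True
      hence "c < 0" using assms by linarith
      thus ?thesis by (simp add: X_def qbinom_eq_0)
    next
      case False
      thus ?thesis using pascal'[of "M - b + 1 + c + a + 1" "M - b + 1"] by (auto simp: algebra_simps)
    qed
    have 2: "?b (M - b + 1 + c + a) (M - b) * ?b M n = ?b (M - b + 1 + c + a) (M - b) *
        (?b (M - 1) n + s powi (2 * (M - n)) * ?b (M - 1) (n - 1))"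
    proof (cases "M = 0 \<and> n = 0")
      case True
      thus ?thesis using assms by (simp add: qbinom_eq_0)
    next
      case False
      thus ?thesis using pascal[of M n] by auto
    qed
    have 3: "X * ?b (M - b + 1 + c + a) (M - b) = X * (s powi (2 * (M - b)) * ?b (M - b + c + a) (M - b)
         + ?b (M - b + c + a) (M - b - 1))"
    proof (cases "M - b = 0 \<and> c + a + 1 = 0")
      case True
      hence "c < 0" using assms by linarith
      thus ?thesis by (simp add: X_def qbinom_eq_0)
    next
      case False
      thus ?thesis using pascal'[of "M - b + 1 + c + a" "M - b"] by (auto simp: algebra_simps)
    qed
    have e1: "s powi (2 * b - 1) * s powi (n\<^sup>2) * s powi (2 * (M - b + 1)) = s powi (2 * M + 1) * s powi (n\<^sup>2)"
      by (simp_all add: powi_mult power2_eq_square algebra_simps)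
    have t: "trin_term s L M (a + 1) (b - 1) c = s powi n\<^sup>2 * ?b M n * (X * ?b (M - b + 1 + c + a + 1) (M - b + 1))"
      "trin_term s L (M - 1) (a + 1) b c = s powi n\<^sup>2 * ?b (M - 1) n * (X * ?b (M - b + c + a) (M - b - 1))"
      "trin_term s (L - 1) M a (b - 1) c = s powi n\<^sup>2 * ?b M n * (X * ?b (M - b + 1 + c + a) (M - b + 1))"
      "A1 c = s powi (2 * b - 1) * s powi n\<^sup>2 * ?b (M - 1) n * (X * (s powi (2 * (M - b)) * ?b (M - b + c + a) (M - b)))"
      "A2 (c + 1) = s powi (2 * b - 1) * s powi n\<^sup>2 * s powi (2 * (M - n)) * ?b (M - 1) (n - 1) * (X * ?b (M - b + 1 + c + a) (M - b))"
    proof -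
      have "s powi (2 * b - 1) * s powi n\<^sup>2 * s powi (2 * (M - b)) = s powi ((L - a - 2 * c)\<^sup>2 + 2 * (M - (L - a - 2 * c)))"
        by (simp add: powi_mult n_def power2_eq_square algebra_simps)
      thus "A1 c = s powi (2 * b - 1) * s powi n\<^sup>2 * ?b (M - 1) n * (X * (s powi (2 * (M - b)) * ?b (M - b + c + a) (M - b)))"
        unfolding A1_def X_def by (simp add: n_def algebra_simps)
      have "s powi (2 * b - 1) * s powi n\<^sup>2 * s powi (2 * (M - n)) = s powi ((L - a - 2 * (c + 1))\<^sup>2 + 2 * (M + b - 1))"
        by (simp add: powi_mult n_def power2_eq_square algebra_simps)
      thus "A2 (c + 1) = s powi (2 * b - 1) * s powi n\<^sup>2 * s powi (2 * (M - n)) * ?b (M - 1) (n - 1) * (X * ?b (M - b + 1 + c + a) (M - b))"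
        unfolding A2_def X_def by (simp add: n_def algebra_simps)
    qed (simp_all add: trin_term_def n_def X_def algebra_simps)
    have "s powi (2 * b - 1) * trin_term s L M (a + 1) (b - 1) c
       = (s powi (2 * b - 1) * s powi (n\<^sup>2) * s powi (2 * (M - b + 1))) * ?b M n * (X * ?b (M - b + 1 + c + a) (M - b + 1))
         + s powi (2 * b - 1) * s powi n\<^sup>2 * X * (?b (M - b + 1 + c + a) (M - b) * ?b M n)"
      unfolding t 1 by (simp add: algebra_simps)
    also have "\<dots> = s powi (2 * M + 1) * trin_term s (L - 1) M a (b - 1) c + A2 (c + 1)
         + s powi (2 * b - 1) * s powi n\<^sup>2 * ?b (M - 1) n * (X * ?b (M - b + 1 + c + a) (M - b))"
      unfolding e1 2 t by (simp add: algebra_simps)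
    also have "s powi (2 * b - 1) * s powi n\<^sup>2 * ?b (M - 1) n * (X * ?b (M - b + 1 + c + a) (M - b))
         = A1 c + s powi (2 * b - 1) * trin_term s L (M - 1) (a + 1) b c"
      unfolding 3 t by (simp add: algebra_simps)
    finally show ?thesis by (simp add: algebra_simps)
  qed
  have "s powi (2 * b - 1) * (trin s K L M (a + 1) (b - 1) - trin s K L (M - 1) (a + 1) b)
       - s powi (2 * M + 1) * trin s K (L - 1) M a (b - 1) = (\<Sum>c\<in>{0..K}. A1 c) + (\<Sum>c\<in>{0..K}. A2 (c + 1))"
    unfolding trin_def sum_distrib_left sum_subtractf[symmetric] sum.distrib[symmetric] B ..
  \<comment> \<open>The end terms vanish: \<open>A2 0\<close> contains [M+b-2; M+b-1], and in
    \<open>A2 (K + 1)\<close> the entry L - a - 2(K+1) is negative.\<close>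
  also have "(\<Sum>c\<in>{0..K}. A2 (c + 1)) = (\<Sum>c\<in>{0..K}. A2 c)"
    using sum_int_shift[of K "\<lambda>c. A2 (c + 1)"] assms by (auto simp: A2_def qbinom_eq_0)
  also have "(\<Sum>c\<in>{0..K}. A1 c) + (\<Sum>c\<in>{0..K}. A2 c)
     = trin s K L M a b - s powi (2 * (M + b)) * (\<Sum>c\<in>{0..K}. trin_term s (L - 1) M (a + 1) b (c - 1))
       - trin s K L (M - 1) a (b - 1)"
    unfolding trin_def sum_distrib_left sum_subtractf[symmetric] sum.distrib[symmetric] A ..
  also have "(\<Sum>c\<in>{0..K}. trin_term s (L - 1) M (a + 1) b (c - 1)) = trin s K (L - 1) M (a + 1) b"
    unfolding trin_def by (rule sum_int_shift) (use assms in \<open>auto intro!: trin_term_eq_0\<close>)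
  finally show ?thesis .
qed

text \<open>Summation by parts. By q-Pascal the weight at L - 1 is, up to powers of s, the
  difference of [L+M-i; L] and its neighbour at i + 1; shifting i moves the difference onto the
  trinomials. The factor s^(-1) arises from (i-1)^2 + 2(i-1) = i^2 - 1.\<close>

lemma trin_sum_mult:
  assumes "1 \<le> L" "0 \<le> M"
  shows "s powi (2 * M) * trin_sum s K (L - 1) M a b =
    (\<Sum>i\<in>{0..M}. s powi (i\<^sup>2) * qbinom (s\<^sup>2) (L + M - i) L
      * (s powi (2 * i) * trin s K (L - i - 1) i a b - s powi (-1) * trin s K (L - i) (i - 1) a b))"
proof -
  let ?b = "qbinom (s\<^sup>2)"
  have 1: "s powi (2 * M) * ?b (L - 1 + M - i) (L - 1) = s powi (2 * i) * (?b (L + M - i) L - ?b (L + M - i - 1) L)"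
    for i
  proof -
    have "?b (L + M - i) L = ?b (L + M - i - 1) L + s powi (2 * (M - i)) * ?b (L + M - i - 1) (L - 1)"
      using pascal[of "L + M - i" L] assms by (auto simp: algebra_simps)
    hence "s powi (2 * i) * (?b (L + M - i) L - ?b (L + M - i - 1) L)
       = (s powi (2 * i) * s powi (2 * (M - i))) * ?b (L + M - i - 1) (L - 1)" by simp
    also have "s powi (2 * i) * s powi (2 * (M - i)) = s powi (2 * M)" by (simp add: powi_mult algebra_simps)
    finally show ?thesis by (simp add: algebra_simps)
  qed
  define f where "f = (\<lambda>i. s powi (i\<^sup>2) * s powi (2 * i) * ?b (L + M - i - 1) L * trin s K (L - i - 1) i a b)"
  have "s powi (2 * M) * trin_sum s K (L - 1) M a b =
     (\<Sum>i\<in>{0..M}. s powi (i\<^sup>2) * (s powi (2 * M) * ?b (L - 1 + M - i) (L - 1)) * trin s K (L - i - 1) i a b)"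
    unfolding trin_sum_def sum_distrib_left by (rule sum.cong) (simp_all add: algebra_simps)
  also have "\<dots> = (\<Sum>i\<in>{0..M}. s powi (i\<^sup>2) * s powi (2 * i) * ?b (L + M - i) L * trin s K (L - i - 1) i a b) - (\<Sum>i\<in>{0..M}. f i)"
    unfolding 1 f_def sum_subtractf[symmetric] by (rule sum.cong) (simp_all add: algebra_simps)
  also have "(\<Sum>i\<in>{0..M}. f i) = (\<Sum>i\<in>{0..M}. f (i - 1))"
    by (rule sum_int_shift[symmetric]) (use assms in \<open>auto simp: f_def trin_eq_0 qbinom_eq_0\<close>)
  also have "\<dots> = (\<Sum>i\<in>{0..M}. s powi (i\<^sup>2) * s powi (-1) * ?b (L + M - i) L * trin s K (L - i) (i - 1) a b)"
  proof (rule sum.cong)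
    fix i
    have "s powi ((i - 1)\<^sup>2) * s powi (2 * (i - 1)) = s powi (i\<^sup>2) * s powi (-1)"
      unfolding powi_mult by (simp add: power2_eq_square algebra_simps)
    thus "f (i - 1) = s powi (i\<^sup>2) * s powi (-1) * ?b (L + M - i) L * trin s K (L - i) (i - 1) a b"
      unfolding f_def by (simp add: algebra_simps)
  qed simp
  finally show ?thesis
    unfolding sum_subtractf[symmetric] by (simp add: algebra_simps)
qed

text \<open>In \<open>trin_descent\<close> at (L - i, i) the terms with (L - i - 1, i) and (L - i, i
  - 1) pair up into exactly the differences of \<open>trin_sum_mult\<close>, so that weighting by
  [L+M-i; L] and summing leaves no trace of i - 1.\<close>

lemma trin_sum_shift:
  assumes "1 \<le> b" "0 \<le> a" "0 \<le> M" "1 \<le> L" "L \<le> K"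
  shows "s powi (2 * b - 1) * trin_sum s K L M (a + 1) (b - 1)
       + s powi (2 * (M + b)) * trin_sum s K (L - 1) M (a + 1) b
    = trin_sum s K L M a b + s powi (2 * M + 1) * trin_sum s K (L - 1) M a (b - 1)"
proof -
  let ?E = "\<lambda>i. s powi (i\<^sup>2) * qbinom (s\<^sup>2) (L + M - i) L"
  let ?D = "\<lambda>a b i. s powi (2 * i) * trin s K (L - i - 1) i a b - s powi (-1) * trin s K (L - i) (i - 1) a b"
  have e: "s powi (2 * (M + b)) = s powi (2 * b) * s powi (2 * M)" "s powi (2 * M + 1) = s * s powi (2 * M)"
    using s0 by (simp_all add: power_int_add algebra_simps)
  have "s powi (2 * b - 1) * trin s K (L - i) i (a + 1) (b - 1) + s powi (2 * b) * ?D (a + 1) b i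
     = trin s K (L - i) i a b + s * ?D a (b - 1) i" if "i \<in> {0..M}" for i
  proof -
    have "s powi (2 * (i + b)) = s powi (2 * b) * s powi (2 * i)" "s powi (2 * i + 1) = s * s powi (2 * i)"
      "s powi (2 * b - 1) = s powi (2 * b) * s powi (-1)"
      using s0 by (simp_all add: power_int_add power_int_diff power_int_minus divide_inverse algebra_simps)
    moreover have m: "s * (inverse s * x) = x" for x using s0 by simp
    ultimately show ?thesis
      using trin_descent[of b a i "L - i" K] assms that by (simp add: algebra_simps m)
  qed
  hence "(\<Sum>i\<in>{0..M}. ?E i * (s powi (2 * b - 1) * trin s K (L - i) i (a + 1) (b - 1) + s powi (2 * b) * ?D (a + 1) b i))
     = (\<Sum>i\<in>{0..M}. ?E i * (trin s K (L - i) i a b + s * ?D a (b - 1) i))"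
    by (intro sum.cong refl) simp
  hence "s powi (2 * b - 1) * trin_sum s K L M (a + 1) (b - 1) + s powi (2 * b) * (\<Sum>i\<in>{0..M}. ?E i * ?D (a + 1) b i)
     = trin_sum s K L M a b + s * (\<Sum>i\<in>{0..M}. ?E i * ?D a (b - 1) i)"
    unfolding trin_sum_def sum_distrib_left sum.distrib[symmetric]
    by (simp add: distrib_left mult_ac cong: sum.cong)
  thus ?thesis unfolding e trin_sum_mult[OF assms(4,3), symmetric] by (simp add: mult.assoc)
qed

lemma trin_sum_0:
  assumes "0 \<le> a" "0 \<le> M" "0 \<le> L" "L \<le> K"
  shows "trin_sum s K L M a 0 = trin s K L M a 0"
proof -
  let ?b = "qbinom (s\<^sup>2)"
  let ?t = "\<lambda>i c. s powi (i\<^sup>2) * ?b (L + M - i) L * trin_term s (L - i) i a 0 c"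
  have "trin_sum s K L M a 0 = (\<Sum>i\<in>{0..M}. \<Sum>c\<in>{0..K}. ?t i c)"
    unfolding trin_sum_def trin_def sum_distrib_left ..
  \<comment> \<open>The substitution r = L - a - i - c is what makes the identity termwise: for
    fixed r, the sum over i will give the summand with index r on the right.\<close>
  also have "\<dots> = (\<Sum>i\<in>{0..M}. \<Sum>r\<in>{0..K}. ?t i (L - a - i - r))"
  proof (rule sum.cong)
    fix i assume i: "i \<in> {0..M}"
    have z: "0 \<le> c \<and> 2 * c \<le> L - i - a \<and> L - i - a - 2 * c \<le> i" if "?t i c \<noteq> 0" for c
      using that trin_term_eq_0[of c a "L - i" i 0 s] by (metis linorder_not_le diff_ge_0_iff_ge mult_zero_right)
    show "(\<Sum>c\<in>{0..K}. ?t i c) = (\<Sum>r\<in>{0..K}. ?t i (L - a - i - r))"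
    proof (rule sum.reindex_bij_witness_not_neutral[where S' = "{c \<in> {0..K}. ?t i c = 0}"
            and T' = "{r \<in> {0..K}. ?t i (L - a - i - r) = 0}"
            and i = "\<lambda>r. L - a - i - r" and j = "\<lambda>c. L - a - i - c"])
      fix c assume c: "c \<in> {0..K} - {c \<in> {0..K}. ?t i c = 0}"
      hence "0 \<le> c \<and> 2 * c \<le> L - i - a \<and> L - i - a - 2 * c \<le> i" using z by blast
      thus "L - a - i - c \<in> {0..K} - {r \<in> {0..K}. ?t i (L - a - i - r) = 0}"
        using c assms i by auto
    next
      fix r assume r: "r \<in> {0..K} - {r \<in> {0..K}. ?t i (L - a - i - r) = 0}"
      hence "0 \<le> L - a - i - r \<and> 2 * (L - a - i - r) \<le> L - i - a \<and> L - i - a - 2 * (L - a - i - r) \<le> i" using z by blast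
      thus "L - a - i - r \<in> {0..K} - {c \<in> {0..K}. ?t i c = 0}"
        using r assms i by auto
    qed (auto intro!: finite_subset[of _ "{0..K}"])
  qed simp
  also have "\<dots> = (\<Sum>r\<in>{0..K}. \<Sum>i\<in>{0..M}. ?t i (L - a - i - r))" by (rule sum.swap)
  also have "\<dots> = (\<Sum>r\<in>{0..K}. trin_term s L M a 0 r)"
  proof (rule sum.cong)
    fix r assume r: "r \<in> {0..K}"
    \<comment> \<open>The n of the right-hand summand with index r; the n of the inner trinomial
      becomes i - e.\<close>
    define e where "e = L - a - 2 * r"
    have t: "?t i (L - a - i - r) = s powi (i\<^sup>2) * s powi ((i - e)\<^sup>2) * ?b (L + M - i) L
        * ?b i (i - e) * ?b (r + e) i * ?b (r + a + e) i" for i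
      by (simp add: trin_term_def e_def algebra_simps)
    have t': "trin_term s L M a 0 r = s powi (e\<^sup>2) * ?b M e * ?b (M + r) M * ?b (M + r + a) M"
      by (simp add: trin_term_def e_def)
    have L: "L = r + (r + a) + e" by (simp add: e_def)
    show "(\<Sum>i\<in>{0..M}. ?t i (L - a - i - r)) = trin_term s L M a 0 r"
    proof (cases "e < 0")
      case True
      thus ?thesis unfolding t t' by (simp add: qbinom_eq_0)
    next
      case False
      \<comment> \<open>Reversing the order gives the Saalschuetz sum with \<open>M1 = r\<close>,
        \<open>M2 = r + a + e\<close>, \<open>R = M - e\<close>, \<open>S = M\<close>, after
        [r+e; e] has been pulled out by \<open>qbinom_trinomial\<close>.\<close>
      have "(\<Sum>i\<in>{0..M}. ?t i (L - a - i - r)) = (\<Sum>k\<in>{0..M}. ?t (M - k) (L - a - (M - k) - r))"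
        by (rule sum.reindex_bij_witness[where i = "\<lambda>k. M - k" and j = "\<lambda>k. M - k"]) auto
      also have "\<dots> = s powi (e\<^sup>2) * ?b (r + e) e * (\<Sum>k\<in>{0..M}. s powi (2 * ((M - k) * (M - e - k)))
          * ?b (r + (r + a + e) + k) k * ?b r (M - e - k) * ?b (r + a + e) (M - k))"
        unfolding sum_distrib_left
      proof (rule sum.cong)
        fix k assume "k \<in> {0..M}"
        have 1: "?b (M - k) (M - k - e) * ?b (r + e) (M - k) = ?b (r + e) e * ?b r (M - e - k)"
          using qbinom_trinomial[OF norm_s2, of "r + e" "M - k" e] qbinom_sym[of "s\<^sup>2" "M - k" e]
          by (simp add: mult.commute algebra_simps)
        have 2: "?b (L + M - (M - k)) L = ?b (r + (r + a + e) + k) k"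
          using qbinom_sym[of "s\<^sup>2" "L + k" k] L by (simp add: algebra_simps)
        have 3: "s powi ((M - k)\<^sup>2) * s powi ((M - k - e)\<^sup>2) = s powi (e\<^sup>2) * s powi (2 * ((M - k) * (M - e - k)))"
          unfolding powi_mult by (simp add: power2_eq_square algebra_simps)
        have "?t (M - k) (L - a - (M - k) - r) = (s powi ((M - k)\<^sup>2) * s powi ((M - k - e)\<^sup>2)) *
           ?b (L + M - (M - k)) L * (?b (M - k) (M - k - e) * ?b (r + e) (M - k)) * ?b (r + a + e) (M - k)"
          unfolding t by (simp only: mult_ac)
        thus "?t (M - k) (L - a - (M - k) - r) = s powi (e\<^sup>2) * ?b (r + e) e * (s powi (2 * ((M - k) * (M - e - k)))
          * ?b (r + (r + a + e) + k) k * ?b r (M - e - k) * ?b (r + a + e) (M - k))"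
          unfolding 1 2 3 by (simp only: mult_ac)
      qed simp
      also have "\<dots> = s powi (e\<^sup>2) * ?b (r + e) e * (?b (r + M) (M - e) * ?b (r + a + e + (M - e)) M)"
        by (subst qbinom_saalschuetz[OF s0 s1]) (use assms r False in auto)
      finally have fin: "(\<Sum>i\<in>{0..M}. ?t i (L - a - i - r))
          = s powi (e\<^sup>2) * (?b (r + e) e * (?b (r + M) (M - e) * ?b (r + a + e + (M - e)) M))"
        by (simp only: mult.assoc)
      have "?b (r + e) e * (?b (r + M) (M - e) * ?b (r + a + e + (M - e)) M)
          = ?b M e * ?b (M + r) M * ?b (M + r + a) M"
      proof -
        have "?b (M + r) (r + e) * ?b (r + e) e = ?b (M + r) e * ?b (M + r - e) r"
          using qbinom_trinomial[OF norm_s2, of "M + r" "r + e" e] by simp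
        moreover have "?b (M + r) M * ?b M e = ?b (M + r) e * ?b (M + r - e) (M - e)"
          by (rule qbinom_trinomial[OF norm_s2])
        moreover have "?b (M + r - e) (M - e) = ?b (M + r - e) r"
          using qbinom_sym[of "s\<^sup>2" "M + r - e" r] by (simp add: algebra_simps)
        moreover have "?b (r + M) (M - e) = ?b (M + r) (r + e)"
          using qbinom_sym[of "s\<^sup>2" "M + r" "r + e"] by (simp add: algebra_simps)
        ultimately show ?thesis by (simp add: algebra_simps)
      qed
      thus ?thesis unfolding fin t' by (simp only: mult.assoc)
    qed
  qed simp
  finally show ?thesis by (simp add: trin_def)
qed

theorem trin_transformation:
  assumes "0 \<le> a" "0 \<le> b" "0 \<le> M" "0 \<le> L" "L \<le> K"
  shows "trin_sum s K L M a b = s powi (b\<^sup>2) * trin s K L M (a + b) b"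
proof -
  have "trin_sum s K (int l) M a (int j) = s powi ((int j)\<^sup>2) * trin s K (int l) M (a + int j) (int j)"
    if "0 \<le> a" "int l \<le> K" for l j a
    using that
  proof (induction l arbitrary: a j)
    case 0
    show ?case
    proof (cases "j = 0")
      case True
      thus ?thesis using trin_sum_0[of a M 0 K] 0 assms by simp
    next
      case False
      have "trin_sum s K 0 M a (int j) = 0"
        unfolding trin_sum_def
      proof (intro sum.neutral ballI)
        fix i assume "i \<in> {0..M}"
        hence "0 - i < a \<or> i < int j \<or> i < 0" using 0 False by auto
        thus "s powi i\<^sup>2 * qbinom (s\<^sup>2) (0 + M - i) 0 * trin s K (0 - i) i a (int j) = 0"
          by (simp add: trin_eq_0)
      qed
      thus ?thesis using False 0 by (simp add: trin_eq_0)
    qed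
  next
    case (Suc l)
    define L' where "L' = int (Suc l)"
    have l: "int l = L' - 1" by (simp add: L'_def)
    have L': "1 \<le> L'" "L' \<le> K" using Suc.prems by (simp_all add: L'_def)
    \<comment> \<open>Induction on b at fixed L. Each step raises a to a + 1, so a stays arbitrary;
      the terms at L - 1 come from the outer induction hypothesis.\<close>
    have "trin_sum s K L' M a (int j) = s powi ((int j)\<^sup>2) * trin s K L' M (a + int j) (int j)"
      if "0 \<le> a" for a
      using that
    proof (induction j arbitrary: a)
      case 0
      thus ?case using trin_sum_0[of a M L' K] L' assms by simp
    next
      case (Suc j)
      define b where "b = int (Suc j)"
      have b: "1 \<le> b" "int j = b - 1" by (simp_all add: b_def)
      have IH: "trin_sum s K (L' - 1) M a' b' = s powi (b'\<^sup>2) * trin s K (L' - 1) M (a' + b') b'"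
        if "0 \<le> a'" "0 \<le> b'" for a' b'
        using \<open>\<And>a j. 0 \<le> a \<Longrightarrow> int l \<le> K \<Longrightarrow> trin_sum s K (int l) M a (int j) = s powi ((int j)\<^sup>2) * trin s K (int l) M (a + int j) (int j)\<close>[of a' "nat b'"] that L' by (simp add: l)
      have IH2: "trin_sum s K L' M (a + 1) (b - 1) = s powi ((b - 1)\<^sup>2) * trin s K L' M (a + b) (b - 1)"
        using Suc.IH[of "a + 1"] Suc.prems by (simp add: b(2))
      \<comment> \<open>With the weight s^(b^2), these two equalities turn the coefficients of
        \<open>trin_sum_shift\<close> at (a, b) into those of \<open>trin_shift\<close> at (a + b,
        b).\<close>
      have e: "s powi (b\<^sup>2) = s powi (2 * b - 1) * s powi ((b - 1)\<^sup>2)"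
        "s powi (2 * M + 1) * s powi ((b - 1)\<^sup>2) = s powi (b\<^sup>2) * s powi (2 * (M - b + 1))"
        unfolding powi_mult by (simp_all add: power2_eq_square algebra_simps)
      have "trin_sum s K L' M a b = s powi (2 * b - 1) * trin_sum s K L' M (a + 1) (b - 1)
       + s powi (2 * (M + b)) * trin_sum s K (L' - 1) M (a + 1) b
       - s powi (2 * M + 1) * trin_sum s K (L' - 1) M a (b - 1)"
        using trin_sum_shift[of b a M L' K] Suc.prems L' b assms by simp
      also have "\<dots> = s powi (2 * b - 1) * s powi ((b - 1)\<^sup>2) * trin s K L' M (a + b) (b - 1)
       + s powi (b\<^sup>2) * s powi (2 * (M + b)) * trin s K (L' - 1) M (a + b + 1) b
       - s powi (2 * M + 1) * s powi ((b - 1)\<^sup>2) * trin s K (L' - 1) M (a + b - 1) (b - 1)"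
        using IH[of "a + 1" b] IH[of a "b - 1"] Suc.prems b unfolding IH2 by (simp add: algebra_simps)
      also have "\<dots> = s powi (b\<^sup>2) * (trin s K L' M (a + b) (b - 1)
       + s powi (2 * (M + b)) * trin s K (L' - 1) M (a + b + 1) b
       - s powi (2 * (M - b + 1)) * trin s K (L' - 1) M (a + b - 1) (b - 1))"
        unfolding e(2) e(1)[symmetric] by (simp add: algebra_simps)
      also have "\<dots> = s powi (b\<^sup>2) * trin s K L' M (a + b) b"
        using trin_shift[of b "a + b" M L' K] Suc.prems L' b assms by simp
      finally show ?case by (simp only: b_def)
    qed
    thus ?case using Suc.prems by (simp only: L'_def)
  qed
  from this[of a "nat L" "nat b"] show ?thesis using assms by simp
qed

end

section \<open>The seed identity\<close>

lemma sum_nat_le_int: "(\<Sum>n\<in>{..N}. f (int n)) = (\<Sum>n\<in>{0..int N}. f n)"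
  by (rule sum.reindex_bij_witness[where i = nat and j = int]) auto

lemma refined_qtrinomial_int:
  assumes "M \<ge> 0"
  shows "refined_qtrinomial s L M a b =
     (\<Sum>n\<in>{0..M}. if even (L - a - n) then
        s powi (n\<^sup>2) * qbinom (s\<^sup>2) M n
        * qbinom (s\<^sup>2) (M + b + (L - a - n) div 2) (M + b)
        * qbinom (s\<^sup>2) (M - b + (L + a - n) div 2) (M - b) else 0)" (is "_ = sum ?f _")
proof -
  have p: "s powi (int n)\<^sup>2 = s ^ n\<^sup>2" for n
    by (metis of_nat_power power_int_of_nat)
  have "refined_qtrinomial s L M a b = (\<Sum>n\<in>{..nat M}. ?f (int n))"
    unfolding refined_qtrinomial_finite[OF assms]
    by (rule sum.mono_neutral_cong_left) (auto simp: cong_iff_dvd_diff p)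
  thus ?thesis using sum_nat_le_int[of ?f "nat M"] assms by simp
qed

text \<open>The sign change swaps the last two binomials and keeps the parity of n. It carries
  results for a, b \<ge> 0 over to a, b \<le> 0, as needed for negative j.\<close>

lemma refined_qtrinomial_uminus:
  assumes "M \<ge> 0"
  shows "refined_qtrinomial s L M (- a) (- b) = refined_qtrinomial s L M a b"
proof -
  have "even (L - (- a) - n) = even (L - a - n)" for n by simp
  thus ?thesis unfolding refined_qtrinomial_int[OF assms]
    by (intro sum.cong) (auto simp: mult_ac)
qed

lemma refined_qtrinomial_eq_trin:
  assumes "0 \<le> a" "0 \<le> M" "L \<le> K" "0 \<le> K"
  shows "refined_qtrinomial s L M a b = trin s K L M a b"
proof -
  let ?f = "\<lambda>n. if even (L - a - n) then
        s powi (n\<^sup>2) * qbinom (s\<^sup>2) M n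
        * qbinom (s\<^sup>2) (M + b + (L - a - n) div 2) (M + b)
        * qbinom (s\<^sup>2) (M - b + (L + a - n) div 2) (M - b) else 0"
  have 1: "?f (L - a - 2 * c) = trin_term s L M a b c" for c
  proof -
    have "(L - a - (L - a - 2 * c)) div 2 = c" "(L + a - (L - a - 2 * c)) div 2 = c + a" by simp_all
    thus ?thesis by (simp add: trin_term_def algebra_simps)
  qed
  have "(\<Sum>c\<in>{0..K}. trin_term s L M a b c) = sum ?f {0..M}"
  proof (rule sum.reindex_bij_witness_not_neutral[where S' = "{c \<in> {0..K}. trin_term s L M a b c = 0}"
        and T' = "{n \<in> {0..M}. ?f n = 0}"
        and i = "\<lambda>n. (L - a - n) div 2" and j = "\<lambda>c. L - a - 2 * c"])
    fix c assume c: "c \<in> {0..K} - {c \<in> {0..K}. trin_term s L M a b c = 0}"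
    show "(L - a - (L - a - 2 * c)) div 2 = c" by simp
    have "0 \<le> L - a - 2 * c \<and> L - a - 2 * c \<le> M"
      using c trin_term_eq_0[of c a L M b s] by force
    thus "L - a - 2 * c \<in> {0..M} - {n \<in> {0..M}. ?f n = 0}" using c 1[of c] by auto
  next
    fix c show "?f (L - a - 2 * c) = trin_term s L M a b c" by (rule 1)
  next
    fix n assume n: "n \<in> {0..M} - {n \<in> {0..M}. ?f n = 0}"
    hence "?f n \<noteq> 0" by blast
    hence e: "even (L - a - n)" by (rule contrapos_np) (simp only: if_False)
    define c where "c = (L - a - n) div 2"
    have nc: "n = L - a - 2 * c" using e by (simp add: c_def)
    thus "L - a - 2 * ((L - a - n) div 2) = n" by (simp add: c_def)
    have nz: "trin_term s L M a b c \<noteq> 0" using n 1[of c] nc by auto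
    hence "0 \<le> c" using trin_term_eq_0[of c a L M b s] by force
    thus "(L - a - n) div 2 \<in> {0..K} - {c \<in> {0..K}. trin_term s L M a b c = 0}"
      using nz n assms nc unfolding c_def[symmetric] by auto
  qed (auto intro: finite_subset[of _ "{0..M}"] finite_subset[of _ "{0..K}"])
  thus ?thesis by (simp add: refined_qtrinomial_int assms trin_def)
qed

section \<open>The q-binomial theorem and the splitting of the odd powers\<close>

lemma coeff_sum_monom: "coeff (\<Sum>m\<le>N. monom (f m) m) k = (if k \<le> N then f k else 0)"
  by (simp add: coeff_sum)

text \<open>Stated for polynomials, so that coefficients can be compared and then reweighted. The
  induction step, read off at the coefficient of x^(j+1), is q-Pascal.\<close>

lemma q_binomial_theorem_poly:
  assumes "norm p < 1"
  shows "(\<Prod>k<N. [:1, t * p ^ (2 * k + 1):]) = (\<Sum>m\<le>N. monom (t ^ m * p ^ m\<^sup>2 * qbinom (p\<^sup>2) (int N) (int m)) m)"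
proof (induction N)
  case 0
  have "norm (p\<^sup>2) < 1" using assms by (simp add: norm_power power_less_one_iff)
  thus ?case by (simp add: monom_0 one_pCons)
next
  case (Suc N)
  have n2: "norm (p\<^sup>2) < 1" using assms by (simp add: norm_power power_less_one_iff)
  let ?f = "\<lambda>N m. t ^ m * p ^ m\<^sup>2 * qbinom (p\<^sup>2) (int N) (int m)"
  have c: "coeff (\<Sum>m\<le>N. monom (?f N m) m) k = ?f N k" for k N
    unfolding coeff_sum_monom by (simp add: qbinom_eq_0)
  show ?case unfolding prod.lessThan_Suc Suc
  proof (rule poly_eqI)
    fix k
    show "coeff ((\<Sum>m\<le>N. monom (?f N m) m) * [:1, t * p ^ (2 * N + 1):]) k
        = coeff (\<Sum>m\<le>Suc N. monom (?f (Suc N) m) m) k"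
    proof (cases k)
      case 0
      thus ?thesis unfolding c using n2 by (simp add: coeff_mult c)
    next
      case (Suc j)
      have "coeff ((\<Sum>m\<le>N. monom (?f N m) m) * [:1, t * p ^ (2 * N + 1):]) k
          = ?f N (Suc j) + t * p ^ (2 * N + 1) * ?f N j"
        using c[of N] Suc by (simp add: mult.commute[of _ "[:1, _:]"] algebra_simps)
      also have "\<dots> = ?f (Suc N) (Suc j)"
      proof (cases "j \<le> N")
        case True
        have e: "p ^ (2 * N + 1) * p ^ j\<^sup>2 = p ^ (Suc j)\<^sup>2 * (p\<^sup>2) ^ (N - j)"
          using True unfolding power_mult[symmetric] power_add[symmetric]
          by (intro arg_cong[of _ _ "\<lambda>e. p ^ e"]) (simp add: power2_eq_square algebra_simps)
        have "?f N (Suc j) + t * p ^ (2 * N + 1) * ?f N j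
          = ?f N (Suc j) + t ^ Suc j * (p ^ (2 * N + 1) * p ^ j\<^sup>2) * qbinom (p\<^sup>2) (int N) (int j)"
          by (simp add: algebra_simps)
        also have "\<dots> = ?f (Suc N) (Suc j)"
          unfolding e qbinom_pascal_nat[OF n2] by (simp add: algebra_simps)
        finally show ?thesis .
      next
        case False
        thus ?thesis by (simp add: qbinom_eq_0)
      qed
      finally show ?thesis unfolding c Suc .
    qed
  qed
qed

text \<open>The odd exponents are sorted by residue mod 6: 6k+1, 6k+3 and 6k+5 are 3(2k+1) plus -2,
  0 and 2. The factors 1 keep each product in the form of
  \<open>q_binomial_theorem_poly\<close>.\<close>

lemma prod_odd_powers_split:
  fixes q :: complex
  assumes "q \<noteq> 0"
  shows "(\<Prod>k<3 * M. [:1, 1 * q ^ (2 * k + 1):]) =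
    (\<Prod>k<M. [:1, 1 * (q ^ 3) ^ (2 * k + 1):]) * (\<Prod>k<M. [:1, inverse (q\<^sup>2) * (q ^ 3) ^ (2 * k + 1):])
     * (\<Prod>k<M. [:1, q\<^sup>2 * (q ^ 3) ^ (2 * k + 1):])"
proof (induction M)
  case (Suc M)
  have r: "(q ^ 3) ^ (2 * M + 1) = q\<^sup>2 * q ^ (2 * (3 * M) + 1)"
    unfolding power_mult[symmetric] power_add[symmetric] by (rule arg_cong[of _ _ "\<lambda>e. q ^ e"]) simp
  have e: "inverse (q\<^sup>2) * (q ^ 3) ^ (2 * M + 1) = q ^ (2 * (3 * M) + 1)"
    "(q ^ 3) ^ (2 * M + 1) = q ^ (2 * Suc (3 * M) + 1)"
    "q\<^sup>2 * (q ^ 3) ^ (2 * M + 1) = q ^ (2 * Suc (Suc (3 * M)) + 1)"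
    unfolding r using assms by (simp_all add: power2_eq_square field_simps)
  have 3: "3 * Suc M = Suc (Suc (Suc (3 * M)))" by simp
  have "(\<Prod>k<3 * Suc M. [:1, 1 * q ^ (2 * k + 1):]) = (\<Prod>k<3 * M. [:1, 1 * q ^ (2 * k + 1):])
      * ([:1, q ^ (2 * (3 * M) + 1):] * [:1, q ^ (2 * Suc (3 * M) + 1):] * [:1, q ^ (2 * Suc (Suc (3 * M)) + 1):])"
    by (simp only: 3 prod.lessThan_Suc mult_1 mult.assoc)
  thus ?case unfolding Suc prod.lessThan_Suc e(1,3) unfolding mult_1 unfolding e(2) by (simp only: mult_ac)
qed simp

text \<open>The linear functional x^m \<mapsto> \<open>H m\<close> is applied to both expansions of
  the split product. \<open>H\<close> is arbitrary here; the seed inserts the binomial that depends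
  on m.\<close>

lemma qbinom_triple_expansion:
  fixes q :: complex and H :: "nat \<Rightarrow> complex"
  assumes q0: "q \<noteq> 0" and q1: "norm q < 1"
  shows "(\<Sum>m\<le>3 * M. q ^ m\<^sup>2 * qbinom (q\<^sup>2) (int (3 * M)) (int m) * H m) =
    (\<Sum>n\<le>M. \<Sum>u\<le>M. \<Sum>v\<le>M. (q ^ 3) ^ n\<^sup>2 * qbinom ((q ^ 3)\<^sup>2) (int M) (int n)
       * (inverse (q\<^sup>2) ^ u * (q ^ 3) ^ u\<^sup>2 * qbinom ((q ^ 3)\<^sup>2) (int M) (int u))
       * ((q\<^sup>2) ^ v * (q ^ 3) ^ v\<^sup>2 * qbinom ((q ^ 3)\<^sup>2) (int M) (int v)) * H (n + u + v))"
proof -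
  have q3: "norm (q ^ 3) < 1" using q1 by (simp add: norm_power power_less_one_iff)
  define F where "F = (\<lambda>t m. t ^ m * (q ^ 3) ^ m\<^sup>2 * qbinom ((q ^ 3)\<^sup>2) (int M) (int m))"
  define P where "P = (\<Sum>m\<le>3 * M. monom (1 ^ m * q ^ m\<^sup>2 * qbinom (q\<^sup>2) (int (3 * M)) (int m)) m)"
  have "P = (\<Sum>n\<le>M. monom (F 1 n) n) * (\<Sum>u\<le>M. monom (F (inverse (q\<^sup>2)) u) u) * (\<Sum>v\<le>M. monom (F (q\<^sup>2) v) v)"
    unfolding P_def q_binomial_theorem_poly[OF q1, symmetric] F_def q_binomial_theorem_poly[OF q3, symmetric]
    by (rule prod_odd_powers_split[OF q0])
  also have "\<dots> = (\<Sum>n\<le>M. \<Sum>u\<le>M. \<Sum>v\<le>M. monom (F 1 n * F (inverse (q\<^sup>2)) u * F (q\<^sup>2) v) (n + u + v))"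
    unfolding mult.assoc sum_product unfolding sum_distrib_right unfolding sum_distrib_left mult_monom
    by (simp only: add.assoc mult.assoc) (rule sum.cong[OF refl], rule sum.swap)
  finally have P: "P = \<dots>" .
  have "(\<Sum>m\<le>3 * M. q ^ m\<^sup>2 * qbinom (q\<^sup>2) (int (3 * M)) (int m) * H m) = (\<Sum>m\<le>3 * M. coeff P m * H m)"
    unfolding P_def coeff_sum_monom by (intro sum.cong) auto
  also have "\<dots> = (\<Sum>m\<le>3 * M. \<Sum>n\<le>M. \<Sum>u\<le>M. \<Sum>v\<le>M.
      (if n + u + v = m then F 1 n * F (inverse (q\<^sup>2)) u * F (q\<^sup>2) v else 0) * H m)"
    unfolding P by (simp only: coeff_sum sum_distrib_right coeff_monom)
  also have "\<dots> = (\<Sum>n\<le>M. \<Sum>u\<le>M. \<Sum>v\<le>M. \<Sum>m\<le>3 * M.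
      (if n + u + v = m then F 1 n * F (inverse (q\<^sup>2)) u * F (q\<^sup>2) v else 0) * H m)"
    by (rule trans[OF sum.swap], rule sum.cong[OF refl], rule trans[OF sum.swap], rule sum.cong[OF refl], rule sum.swap)
  also have "\<dots> = (\<Sum>n\<le>M. \<Sum>u\<le>M. \<Sum>v\<le>M. F 1 n * F (inverse (q\<^sup>2)) u * F (q\<^sup>2) v * H (n + u + v))"
    by (intro sum.cong refl) (simp add: if_distrib[of "\<lambda>x. x * _"] cong: if_cong)
  finally show ?thesis by (simp add: F_def)
qed

context half_base
begin

text \<open>With R = (L-j-n)/2 and S = R + j, the last two binomials of the trinomial are [M+S; R]
  and [M+R; S], a Saalschuetz product with \<open>M1 = M2 = M\<close>. Putting k = S - v and u = v -
  j, its sum has the factors [M; u], [M; v] and a third that depends only on n + u + v, namely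
  \<open>H\<close>; the powers fit because (v-u)^2 + 2uv = u^2 + v^2. The bound M \<le> J lets j = v
  - u range over everything that occurs.\<close>

lemma sum_trin_diagonal:
  fixes L J :: int and M :: nat
  assumes J: "int M \<le> J"
  defines "H \<equiv> \<lambda>m :: int. if even (L - m) then qbinom (s\<^sup>2) (2 * int M + (L - m) div 2) (2 * int M) else 0"
  shows "(\<Sum>j\<in>{-J..J}. s powi (j\<^sup>2) * z powi j * refined_qtrinomial s L (int M) j j) =
    (\<Sum>n\<in>{0..int M}. \<Sum>v\<in>{0..int M}. \<Sum>u\<in>{0..int M}.
       s powi (n\<^sup>2 + u\<^sup>2 + v\<^sup>2) * z powi (v - u) * qbinom (s\<^sup>2) (int M) n
       * qbinom (s\<^sup>2) (int M) u * qbinom (s\<^sup>2) (int M) v * H (n + u + v))"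
proof -
  let ?b = "qbinom (s\<^sup>2)" and ?M = "int M"
  define W where "W = (\<lambda>n v u. s powi (n\<^sup>2 + u\<^sup>2 + v\<^sup>2) * z powi (v - u) * ?b ?M n * ?b ?M u * ?b ?M v * H (n + u + v))"
  have A: "s powi (j\<^sup>2) * z powi j * (if even (L - j - n) then
        s powi (n\<^sup>2) * ?b ?M n * ?b (?M + j + (L - j - n) div 2) (?M + j)
        * ?b (?M - j + (L + j - n) div 2) (?M - j) else 0) = (\<Sum>v\<in>{0..?M}. W n v (v - j))" for j n
  proof (cases "even (L - j - n)")
    case False
    hence "odd (L - (n + (v - j) + v))" for v by presburger
    hence "H (n + (v - j) + v) = 0" for v by (simp only: H_def if_False)
    thus ?thesis using False by (simp add: W_def)
  next
    case True
    define R where "R = (L - j - n) div 2"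
    define S where "S = R + j"
    have R: "L - j - n = 2 * R" using True by (simp add: R_def)
    have S: "(L + j - n) div 2 = S" using R by (simp add: S_def)
    have 1: "?b (?M + j + R) (?M + j) = ?b (?M + S) R"
      using qbinom_sym[of "s\<^sup>2" "?M + S" R] by (simp add: S_def algebra_simps)
    have 2: "?b (?M - j + S) (?M - j) = ?b (?M + R) S"
      using qbinom_sym[of "s\<^sup>2" "?M + R" S] by (simp add: S_def algebra_simps)
    define f where "f = (\<lambda>k. s powi (2 * ((S - k) * (R - k))) * ?b (?M + ?M + k) k * ?b ?M (R - k) * ?b ?M (S - k))"
    have "(\<Sum>k\<in>{0..S}. f k) = (\<Sum>v\<in>{0..?M}. f (S - v))"
      by (rule sum.reindex_bij_witness_not_neutral[where S' = "{k \<in> {0..S}. ?M < S - k}"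
          and T' = "{v \<in> {0..?M}. S < v}" and i = "\<lambda>v. S - v" and j = "\<lambda>k. S - k"])
        (auto simp: f_def qbinom_eq_0 intro: finite_subset[of _ "{0..S}"] finite_subset[of _ "{0..?M}"])
    also have "s powi (j\<^sup>2) * z powi j * (s powi (n\<^sup>2) * ?b ?M n * \<dots>) = (\<Sum>v\<in>{0..?M}. W n v (v - j))"
      unfolding sum_distrib_left
    proof (rule sum.cong)
      fix v
      have d: "L - (n + (v - j) + v) = 2 * (S - v)" using R by (simp add: S_def)
      have H: "H (n + (v - j) + v) = ?b (2 * ?M + (S - v)) (2 * ?M)" unfolding H_def d by simp
      have 3: "?b (?M + ?M + (S - v)) (S - v) = ?b (2 * ?M + (S - v)) (2 * ?M)"
        using qbinom_sym[of "s\<^sup>2" "2 * ?M + (S - v)" "S - v"] by (simp add: algebra_simps)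
      have 4: "R - (S - v) = v - j" "S - (S - v) = v" by (simp_all add: S_def)
      have e: "s powi (n\<^sup>2 + (v - j)\<^sup>2 + v\<^sup>2) = s powi (j\<^sup>2) * s powi (n\<^sup>2) * s powi (2 * (v * (v - j)))"
        unfolding powi_mult by (simp add: power2_eq_square algebra_simps)
      show "s powi (j\<^sup>2) * z powi j * (s powi (n\<^sup>2) * ?b ?M n * f (S - v)) = W n v (v - j)"
        unfolding f_def W_def H 3 4 e by simp
    qed simp
    finally show ?thesis
      using True qbinom_saalschuetz[OF s0 s1, of ?M ?M S R] unfolding R_def[symmetric] S 1 2 f_def
      by (simp add: mult.assoc)
  qed
  have "(\<Sum>j\<in>{-J..J}. s powi (j\<^sup>2) * z powi j * refined_qtrinomial s L ?M j j)
     = (\<Sum>j\<in>{-J..J}. \<Sum>n\<in>{0..?M}. \<Sum>v\<in>{0..?M}. W n v (v - j))"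
    unfolding refined_qtrinomial_int[OF of_nat_0_le_iff] sum_distrib_left A ..
  also have "\<dots> = (\<Sum>n\<in>{0..?M}. \<Sum>v\<in>{0..?M}. \<Sum>j\<in>{-J..J}. W n v (v - j))"
    by (rule trans[OF sum.swap], rule sum.cong[OF refl], rule sum.swap)
  also have "\<dots> = (\<Sum>n\<in>{0..?M}. \<Sum>v\<in>{0..?M}. \<Sum>u\<in>{0..?M}. W n v u)"
  proof (rule sum.cong[OF refl], rule sum.cong[OF refl])
    fix n v assume "v \<in> {0..?M}"
    thus "(\<Sum>j\<in>{-J..J}. W n v (v - j)) = (\<Sum>u\<in>{0..?M}. W n v u)"
      by (intro sum.reindex_bij_witness_not_neutral[where S' = "{j \<in> {-J..J}. v < j \<or> ?M < v - j}"
          and T' = "{}" and i = "\<lambda>u. v - u" and j = "\<lambda>j. v - j"])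
        (use J in \<open>auto simp: W_def qbinom_eq_0 intro: finite_subset[of _ "{-J..J}"]\<close>)
  qed
  finally show ?thesis by (simp add: W_def)
qed

end

section \<open>Iteration\<close>

text \<open>The case \<open>\<nu> = 0\<close> is not covered by the general formula; it is the summand of the seed
  identity from which the cases \<open>\<nu> \<ge> 1\<close> are obtained by iteration.\<close>

definition cap_term :: "complex \<Rightarrow> nat \<Rightarrow> int \<Rightarrow> int \<Rightarrow> nat \<Rightarrow> (nat \<Rightarrow> nat) \<Rightarrow> complex" where
  "cap_term q \<nu> L M m n =
    (if \<nu> = 0 then
       (if even (L - int m) then q ^ m\<^sup>2 * qbinom (q\<^sup>2) (3 * M) (int m)
          * qbinom (q ^ 6) (2 * M + (L - int m) div 2) (2 * M) else 0)
     else if even (L - int m - int (\<Sum>k=1..\<nu>. tail_sum \<nu> n k)) then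
       q ^ (m\<^sup>2 + 3 * (\<Sum>k=1..\<nu>. (tail_sum \<nu> n k)\<^sup>2))
             * qbinom (q ^ 6) (L + M - int (tail_sum \<nu> n 1)) L
             * qbinom (q\<^sup>2) (3 * int (n \<nu>)) (int m)
             * qbinom (q ^ 6)
                 (2 * int (n \<nu>) + (L - int m - int (\<Sum>k=1..\<nu>. tail_sum \<nu> n k)) div 2)
                 (2 * int (n \<nu>))
             * (\<Prod>j=1..<\<nu>. qbinom (q ^ 6)
                 (L - int (\<Sum>l=1..j. tail_sum \<nu> n l) + int (n j)) (int (n j)))
     else 0)"

text \<open>The right side of the theorem cut off at |j| \<le> J. The cutoff is separate from M
  because the iteration replaces M by varying i \<le> M under the same sum over j.\<close>

definition cap_sum :: "complex \<Rightarrow> int \<Rightarrow> nat \<Rightarrow> int \<Rightarrow> int \<Rightarrow> complex" where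
  "cap_sum q J \<nu> L M = (\<Sum>j\<in>{-J..J}. q powi (3 * (int \<nu> + 1) * j\<^sup>2 + 2 * j)
     * refined_qtrinomial (q ^ 3) L M ((int \<nu> + 1) * j) j)"

lemma cap_term_eq_0:
  assumes "L < 0 \<or> M < int (tail_sum \<nu> n 1) \<and> 0 < \<nu>"
  shows "cap_term q \<nu> L M m n = 0"
proof (cases "\<nu> = 0")
  case True
  hence "(L - int m) div 2 < 0" using assms by (simp add: div_neg_pos_less0)
  thus ?thesis using True by (simp add: cap_term_def qbinom_eq_0)
next
  case False
  thus ?thesis using assms by (auto simp: cap_term_def qbinom_eq_0)
qed

text \<open>Splitting off i = N_1 leaves the same kind of term at (L - i, i) for the shifted tuple.
  For \<nu> \<ge> 1 the factor j = 1 of the product, [L-N_1+n_1; n_1], becomes by symmetry the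
  leading binomial [(L-i)+i-N_2; L-i] of the smaller term; for \<nu> = 0 what is left is the seed
  with M = n_1.\<close>

lemma cap_term_Suc:
  assumes n': "\<And>k. k \<in> {1..\<nu>} \<Longrightarrow> n' k = n (Suc k)"
  defines "i \<equiv> int (tail_sum (Suc \<nu>) n 1)"
  shows "cap_term q (Suc \<nu>) L M m n
    = q ^ (3 * (tail_sum (Suc \<nu>) n 1)\<^sup>2) * qbinom (q ^ 6) (L + M - i) L * cap_term q \<nu> (L - i) i m n'"
proof (cases "\<nu> = 0")
  case True
  have ts: "tail_sum (Suc 0) n 1 = n 1" by (simp add: tail_sum_def)
  have a: "(\<Sum>k=1..Suc 0. tail_sum (Suc 0) n k) = n 1" "(\<Sum>k=1..Suc 0. (tail_sum (Suc 0) n k)\<^sup>2) = (n 1)\<^sup>2"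
    using ts by simp_all
  have d: "L - int m - int (n 1) = L - int (n 1) - int m" by simp
  show ?thesis unfolding cap_term_def i_def True a ts d by (simp add: power_add)
next
  case False
  have ts: "tail_sum (Suc \<nu>) n (Suc k) = tail_sum \<nu> n' k" if "1 \<le> k" for k
    unfolding tail_sum_def sum.shift_bounds_cl_Suc_ivl by (rule sum.cong) (use that n' in auto)
  have split: "(\<Sum>k=1..Suc j. f (tail_sum (Suc \<nu>) n k)) = f (tail_sum (Suc \<nu>) n 1) + (\<Sum>k=1..j. f (tail_sum \<nu> n' k))"
    for f :: "nat \<Rightarrow> nat" and j
  proof -
    have "(\<Sum>k=1..Suc j. f (tail_sum (Suc \<nu>) n k)) = f (tail_sum (Suc \<nu>) n 1) + (\<Sum>k=Suc 1..Suc j. f (tail_sum (Suc \<nu>) n k))"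
      by (rule sum.atLeast_Suc_atMost) simp
    also have "(\<Sum>k=Suc 1..Suc j. f (tail_sum (Suc \<nu>) n k)) = (\<Sum>k=1..j. f (tail_sum \<nu> n' k))"
      unfolding sum.shift_bounds_cl_Suc_ivl by (rule sum.cong) (use ts in auto)
    finally show ?thesis .
  qed
  have i: "i = int (n 1) + int (tail_sum \<nu> n' 1)"
  proof -
    have "tail_sum (Suc \<nu>) n 1 = n 1 + tail_sum (Suc \<nu>) n (Suc 1)"
      unfolding tail_sum_def by (rule sum.atLeast_Suc_atMost) simp
    thus ?thesis unfolding i_def using ts[of 1] by simp
  qed
  have nn: "n (Suc \<nu>) = n' \<nu>" using n'[of \<nu>] False by simp
  have 1: "L - int m - int (\<Sum>k=1..Suc \<nu>. tail_sum (Suc \<nu>) n k)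
      = L - i - int m - int (\<Sum>k=1..\<nu>. tail_sum \<nu> n' k)"
    unfolding split[of "\<lambda>x. x" \<nu>] i_def by simp
  have 2: "(\<Sum>k=1..Suc \<nu>. (tail_sum (Suc \<nu>) n k)\<^sup>2)
      = (tail_sum (Suc \<nu>) n 1)\<^sup>2 + (\<Sum>k=1..\<nu>. (tail_sum \<nu> n' k)\<^sup>2)"
    by (rule split)
  have "(\<Prod>j=1..<Suc \<nu>. qbinom (q ^ 6) (L - int (\<Sum>l=1..j. tail_sum (Suc \<nu>) n l) + int (n j)) (int (n j)))
     = qbinom (q ^ 6) (L - int (\<Sum>l=1..1. tail_sum (Suc \<nu>) n l) + int (n 1)) (int (n 1))
       * (\<Prod>j=Suc 1..<Suc \<nu>. qbinom (q ^ 6) (L - int (\<Sum>l=1..j. tail_sum (Suc \<nu>) n l) + int (n j)) (int (n j)))"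
    by (rule prod.atLeast_Suc_lessThan) (use False in simp)
  also have "qbinom (q ^ 6) (L - int (\<Sum>l=1..1. tail_sum (Suc \<nu>) n l) + int (n 1)) (int (n 1))
     = qbinom (q ^ 6) (L - i + i - int (tail_sum \<nu> n' 1)) (L - i)"
  proof -
    have a: "(\<Sum>l=1..1. tail_sum (Suc \<nu>) n l) = tail_sum (Suc \<nu>) n 1" by simp
    have b: "L - int (tail_sum (Suc \<nu>) n 1) + int (n 1) = L - i + int (n 1)" by (simp add: i_def)
    have c: "L - i + i - int (tail_sum \<nu> n' 1) = L - i + int (n 1)" using i by simp
    show ?thesis unfolding a b c using qbinom_sym[of "q ^ 6" "L - i + int (n 1)" "int (n 1)"] by simp
  qed
  also have "(\<Prod>j=Suc 1..<Suc \<nu>. qbinom (q ^ 6) (L - int (\<Sum>l=1..j. tail_sum (Suc \<nu>) n l) + int (n j)) (int (n j)))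
     = (\<Prod>j=1..<\<nu>. qbinom (q ^ 6) (L - i - int (\<Sum>l=1..j. tail_sum \<nu> n' l) + int (n' j)) (int (n' j)))"
    unfolding prod.shift_bounds_Suc_ivl
  proof (rule prod.cong)
    fix j assume "j \<in> {1..<\<nu>}"
    thus "qbinom (q ^ 6) (L - int (\<Sum>l=1..Suc j. tail_sum (Suc \<nu>) n l) + int (n (Suc j))) (int (n (Suc j)))
      = qbinom (q ^ 6) (L - i - int (\<Sum>l=1..j. tail_sum \<nu> n' l) + int (n' j)) (int (n' j))"
      using n'[of j] unfolding split[of "\<lambda>x. x" j] i_def by (simp add: algebra_simps)
  qed simp
  finally have 3: "(\<Prod>j=1..<Suc \<nu>. qbinom (q ^ 6) (L - int (\<Sum>l=1..j. tail_sum (Suc \<nu>) n l) + int (n j)) (int (n j)))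
    = qbinom (q ^ 6) (L - i + i - int (tail_sum \<nu> n' 1)) (L - i)
      * (\<Prod>j=1..<\<nu>. qbinom (q ^ 6) (L - i - int (\<Sum>l=1..j. tail_sum \<nu> n' l) + int (n' j)) (int (n' j)))" .
  have 4: "q ^ (m\<^sup>2 + 3 * ((tail_sum (Suc \<nu>) n 1)\<^sup>2 + x)) = q ^ (3 * (tail_sum (Suc \<nu>) n 1)\<^sup>2) * q ^ (m\<^sup>2 + 3 * x)" for x
    by (simp add: power_add[symmetric] algebra_simps)
  show ?thesis
  proof (cases "even (L - i - int m - int (\<Sum>k=1..\<nu>. tail_sum \<nu> n' k))")
    case True
    show ?thesis unfolding cap_term_def 1 2 3 4 nn i_def[symmetric]
      using True False by (simp only: if_True if_False nat.simps) (simp only: mult_ac)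
  next
    case odd: False
    show ?thesis unfolding cap_term_def 1 2 3 4 nn i_def[symmetric]
      using odd False by (simp only: if_False nat.simps mult_zero_right)
  qed
qed

lemma sum_PiE_Suc:
  fixes g :: "(nat \<Rightarrow> nat) \<Rightarrow> complex"
  shows "(\<Sum>n\<in>{1..Suc \<nu>} \<rightarrow>\<^sub>E {..B}. g n)
    = (\<Sum>n'\<in>{1..\<nu>} \<rightarrow>\<^sub>E {..B}. \<Sum>x\<le>B. g (\<lambda>k\<in>{1..Suc \<nu>}. if k = 1 then x else n' (k - 1)))"
proof -
  have "(\<Sum>n'\<in>{1..\<nu>} \<rightarrow>\<^sub>E {..B}. \<Sum>x\<le>B. g (\<lambda>k\<in>{1..Suc \<nu>}. if k = 1 then x else n' (k - 1)))
    = (\<Sum>(n', x)\<in>({1..\<nu>} \<rightarrow>\<^sub>E {..B}) \<times> {..B}. g (\<lambda>k\<in>{1..Suc \<nu>}. if k = 1 then x else n' (k - 1)))"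
    by (rule sum.cartesian_product)
  also have "\<dots> = (\<Sum>n\<in>{1..Suc \<nu>} \<rightarrow>\<^sub>E {..B}. g n)"
  proof (rule sum.reindex_bij_witness[where j = "\<lambda>(n', x). \<lambda>k\<in>{1..Suc \<nu>}. if k = 1 then x else n' (k - 1)"
        and i = "\<lambda>n. (\<lambda>k\<in>{1..\<nu>}. n (Suc k), n 1)"])
    fix p assume "p \<in> ({1..\<nu>} \<rightarrow>\<^sub>E {..B}) \<times> {..B}"
    then obtain n' x where p: "p = (n', x)" "n' \<in> {1..\<nu>} \<rightarrow>\<^sub>E {..B}" "x \<le> B" by auto
    let ?n = "\<lambda>k\<in>{1..Suc \<nu>}. if k = 1 then x else n' (k - 1)"
    have "(\<lambda>k\<in>{1..\<nu>}. ?n (Suc k)) = n'"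
      using p(2) by (intro ext) (auto simp: restrict_def PiE_def extensional_def)
    thus "(\<lambda>k\<in>{1..\<nu>}. (case p of (n', x) \<Rightarrow> \<lambda>k\<in>{1..Suc \<nu>}. if k = 1 then x else n' (k - 1)) (Suc k),
         (case p of (n', x) \<Rightarrow> \<lambda>k\<in>{1..Suc \<nu>}. if k = 1 then x else n' (k - 1)) 1) = p"
      by (simp add: p)
    have le: "n' (k - 1) \<le> B" if "k \<in> {1..Suc \<nu>}" "k \<noteq> 1" for k
    proof -
      have "1 \<le> k - 1 \<and> k - 1 \<le> \<nu>" using that unfolding atLeastAtMost_iff by linarith
      hence "k - 1 \<in> {1..\<nu>}" by simp
      thus ?thesis using PiE_mem[OF p(2)] by (simp only: atMost_iff)
    qed
    show "(case p of (n', x) \<Rightarrow> \<lambda>k\<in>{1..Suc \<nu>}. if k = 1 then x else n' (k - 1)) \<in> {1..Suc \<nu>} \<rightarrow>\<^sub>E {..B}"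
      unfolding p(1) prod.case restrict_PiE_iff
    proof
      fix k assume "k \<in> {1..Suc \<nu>}"
      thus "(if k = 1 then x else n' (k - 1)) \<in> {..B}" using le[of k] p(3) by (cases "k = 1") auto
    qed
  next
    fix n assume n: "n \<in> {1..Suc \<nu>} \<rightarrow>\<^sub>E {..B}"
    show "(case (\<lambda>k\<in>{1..\<nu>}. n (Suc k), n 1) of (n', x) \<Rightarrow> \<lambda>k\<in>{1..Suc \<nu>}. if k = 1 then x else n' (k - 1)) = n"
    proof
      fix k
      show "(case (\<lambda>k\<in>{1..\<nu>}. n (Suc k), n 1) of (n', x) \<Rightarrow> \<lambda>k\<in>{1..Suc \<nu>}. if k = 1 then x else n' (k - 1)) k = n k"
      proof (cases "k \<in> {1..Suc \<nu>}")
        case True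
        thus ?thesis by (cases "k = 1") auto
      next
        case False
        thus ?thesis using PiE_arb[OF n False] by (simp only: prod.case restrict_apply if_False)
      qed
    qed
    show "(\<lambda>k\<in>{1..\<nu>}. n (Suc k), n 1) \<in> ({1..\<nu>} \<rightarrow>\<^sub>E {..B}) \<times> {..B}"
      using n by (auto simp: PiE_iff)
  qed auto
  finally show ?thesis ..
qed

lemma refined_qtrinomial_neg:
  assumes "L < 0" "0 \<le> M"
  shows "refined_qtrinomial s L M a b = 0"
proof -
  have "refined_qtrinomial s L M a b = 0" if "0 \<le> a" for a b
    using that assms by (simp add: refined_qtrinomial_eq_trin[of a M L 0] trin_eq_0)
  from this[of a b] this[of "-a" "-b"] show ?thesis
    using refined_qtrinomial_uminus[OF assms(2), of s L a b] by (cases "0 \<le> a") auto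
qed

theorem refined_qtrinomial_transformation:
  fixes s :: complex
  assumes s: "s \<noteq> 0" "norm s < 1" and LM: "0 \<le> L" "0 \<le> M" and ab: "0 \<le> a \<and> 0 \<le> b \<or> a \<le> 0 \<and> b \<le> 0"
  shows "(\<Sum>i\<in>{0..M}. s powi (i\<^sup>2) * qbinom (s\<^sup>2) (L + M - i) L * refined_qtrinomial s (L - i) i a b)
    = s powi (b\<^sup>2) * refined_qtrinomial s L M (a + b) b"
proof -
  interpret half_base s by unfold_locales (use s in auto)
  have "(\<Sum>i\<in>{0..M}. s powi (i\<^sup>2) * qbinom (s\<^sup>2) (L + M - i) L * refined_qtrinomial s (L - i) i a b)
    = s powi (b\<^sup>2) * refined_qtrinomial s L M (a + b) b" if "0 \<le> a" "0 \<le> b" for a b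
  proof -
    have "(\<Sum>i\<in>{0..M}. s powi (i\<^sup>2) * qbinom (s\<^sup>2) (L + M - i) L * refined_qtrinomial s (L - i) i a b)
      = trin_sum s L L M a b"
      unfolding trin_sum_def using that LM
      by (intro sum.cong refl) (simp add: refined_qtrinomial_eq_trin[where K = L])
    also have "\<dots> = s powi (b\<^sup>2) * trin s L L M (a + b) b"
      by (rule trin_transformation) (use that LM in auto)
    finally show ?thesis using that LM by (simp add: refined_qtrinomial_eq_trin[where K = L])
  qed
  note * = this
  show ?thesis
  proof (cases "0 \<le> a \<and> 0 \<le> b")
    case True
    thus ?thesis using *[of a b] by simp
  next
    case False
    have "(\<Sum>i\<in>{0..M}. s powi (i\<^sup>2) * qbinom (s\<^sup>2) (L + M - i) L * refined_qtrinomial s (L - i) i a b)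
      = (\<Sum>i\<in>{0..M}. s powi (i\<^sup>2) * qbinom (s\<^sup>2) (L + M - i) L * refined_qtrinomial s (L - i) i (-a) (-b))"
      by (intro sum.cong refl) (simp add: refined_qtrinomial_uminus)
    also have "\<dots> = s powi (b\<^sup>2) * refined_qtrinomial s L M (- (a + b)) (- b)"
      using *[of "-a" "-b"] ab False by simp
    finally show ?thesis using LM by (simp add: refined_qtrinomial_uminus del: minus_add_distrib)
  qed
qed

section \<open>Induction on \<nu> for nonzero q\<close>

context
  fixes q :: complex
  assumes q0: "q \<noteq> 0" and q1: "norm q < 1"
begin

lemma half_base_cube: "half_base (q ^ 3)"
  by unfold_locales (use q0 q1 in \<open>auto simp: norm_power power_less_one_iff\<close>)

lemma q6: "(q ^ 3)\<^sup>2 = q ^ 6"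
  by (simp add: power_mult[symmetric])

lemma cube_powi: "(q ^ 3) powi e = q powi (3 * e)"
  by (simp add: power_int_mult)

text \<open>The transformation in base q^6 acts on each j separately, which is possible because
  (\<nu> + 1)j and j never have opposite signs. It adds j to the third argument and contributes
  q^(3j^2), and this is the passage from \<nu> to \<nu> + 1.\<close>

lemma cap_sum_Suc:
  assumes "0 \<le> L"
  shows "(\<Sum>i\<le>M. q ^ (3 * i\<^sup>2) * qbinom (q ^ 6) (L + int M - int i) L * cap_sum q J \<nu> (L - int i) (int i))
    = cap_sum q J (Suc \<nu>) L (int M)"
proof -
  interpret half_base "q ^ 3" by (rule half_base_cube)
  let ?e = "\<lambda>\<nu> j. q powi (3 * (int \<nu> + 1) * j\<^sup>2 + 2 * j)"
  have p: "q ^ (3 * i\<^sup>2) = (q ^ 3) powi ((int i)\<^sup>2)" for i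
    unfolding cube_powi by (metis of_nat_mult of_nat_numeral of_nat_power power_int_of_nat)
  have "(\<Sum>i\<le>M. q ^ (3 * i\<^sup>2) * qbinom (q ^ 6) (L + int M - int i) L * cap_sum q J \<nu> (L - int i) (int i))
    = (\<Sum>j\<in>{-J..J}. \<Sum>i\<le>M. ?e \<nu> j * ((q ^ 3) powi ((int i)\<^sup>2) * qbinom ((q ^ 3)\<^sup>2) (L + int M - int i) L
         * refined_qtrinomial (q ^ 3) (L - int i) (int i) ((int \<nu> + 1) * j) j))"
    unfolding cap_sum_def sum_distrib_left p q6 by (subst sum.swap) (simp only: mult_ac)
  also have "\<dots> = (\<Sum>j\<in>{-J..J}. ?e \<nu> j * ((q ^ 3) powi (j\<^sup>2) * refined_qtrinomial (q ^ 3) L (int M) ((int \<nu> + 1) * j + j) j))"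
  proof (rule sum.cong)
    fix j
    have "(\<Sum>i\<le>M. (q ^ 3) powi ((int i)\<^sup>2) * qbinom ((q ^ 3)\<^sup>2) (L + int M - int i) L
         * refined_qtrinomial (q ^ 3) (L - int i) (int i) ((int \<nu> + 1) * j) j)
      = (q ^ 3) powi (j\<^sup>2) * refined_qtrinomial (q ^ 3) L (int M) ((int \<nu> + 1) * j + j) j"
      unfolding sum_nat_le_int[of "\<lambda>i. (q ^ 3) powi (i\<^sup>2) * qbinom ((q ^ 3)\<^sup>2) (L + int M - i) L
         * refined_qtrinomial (q ^ 3) (L - i) i ((int \<nu> + 1) * j) j"]
      by (rule refined_qtrinomial_transformation[OF s0 s1])
         (use assms in \<open>auto simp: zero_le_mult_iff mult_le_0_iff\<close>)
    thus "(\<Sum>i\<le>M. ?e \<nu> j * ((q ^ 3) powi ((int i)\<^sup>2) * qbinom ((q ^ 3)\<^sup>2) (L + int M - int i) L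
         * refined_qtrinomial (q ^ 3) (L - int i) (int i) ((int \<nu> + 1) * j) j))
      = ?e \<nu> j * ((q ^ 3) powi (j\<^sup>2) * refined_qtrinomial (q ^ 3) L (int M) ((int \<nu> + 1) * j + j) j)"
      unfolding sum_distrib_left[symmetric] by simp
  qed simp
  also have "\<dots> = cap_sum q J (Suc \<nu>) L (int M)"
    unfolding cap_sum_def
  proof (rule sum.cong)
    fix j
    have "?e \<nu> j * (q ^ 3) powi (j\<^sup>2) = ?e (Suc \<nu>) j"
      unfolding cube_powi using q0 by (simp add: power_int_add[symmetric] algebra_simps)
    moreover have "(int \<nu> + 1) * j + j = (int (Suc \<nu>) + 1) * j" by (simp add: algebra_simps)
    ultimately show "?e \<nu> j * ((q ^ 3) powi (j\<^sup>2) * refined_qtrinomial (q ^ 3) L (int M) ((int \<nu> + 1) * j + j) j)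
       = ?e (Suc \<nu>) j * refined_qtrinomial (q ^ 3) L (int M) ((int (Suc \<nu>) + 1) * j) j"
      by (simp only: mult.assoc[symmetric])
  qed simp
  finally show ?thesis .
qed

lemma seed_identity:
  assumes "L \<le> int B" "int M \<le> J"
  shows "(\<Sum>m\<le>B. cap_term q 0 L (int M) m n) = cap_sum q J 0 L (int M)"
proof -
  interpret half_base "q ^ 3" by (rule half_base_cube)
  define H where "H = (\<lambda>m :: int. if even (L - m) then qbinom (q ^ 6) (2 * int M + (L - m) div 2) (2 * int M) else 0)"
  let ?b = "qbinom (q ^ 6) (int M)"
  have ct: "cap_term q 0 L (int M) m n = q ^ m\<^sup>2 * qbinom (q\<^sup>2) (int (3 * M)) (int m) * H (int m)" for m
    by (simp add: cap_term_def H_def)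
  \<comment> \<open>Either cutoff captures all nonzero terms: for m > B \<ge> L the binomial in (L -
    m)/2 vanishes, for m > 3M the binomial [3M; m].\<close>
  have "(\<Sum>m\<le>B. cap_term q 0 L (int M) m n) = (\<Sum>m\<le>3 * M. cap_term q 0 L (int M) m n)"
  proof (rule sum.mono_neutral_cong)
    fix m assume "m \<in> {..3 * M} - {..B}"
    hence "L < int m" using assms by auto
    thus "cap_term q 0 L (int M) m n = 0" by (simp add: cap_term_def qbinom_eq_0)
  next
    fix m assume "m \<in> {..B} - {..3 * M}"
    thus "cap_term q 0 L (int M) m n = 0" by (simp add: ct qbinom_eq_0)
  qed auto
  also have "\<dots> = (\<Sum>n\<le>M. \<Sum>u\<le>M. \<Sum>v\<le>M. (q ^ 3) ^ n\<^sup>2 * ?b (int n)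
       * (inverse (q\<^sup>2) ^ u * (q ^ 3) ^ u\<^sup>2 * ?b (int u))
       * ((q\<^sup>2) ^ v * (q ^ 3) ^ v\<^sup>2 * ?b (int v)) * H (int (n + u + v)))"
    unfolding ct by (rule qbinom_triple_expansion[OF q0 q1, of _ "\<lambda>m. H (int m)", unfolded q6])
  also have "\<dots> = (\<Sum>n\<le>M. \<Sum>v\<le>M. \<Sum>u\<le>M. (q ^ 3) powi ((int n)\<^sup>2 + (int u)\<^sup>2 + (int v)\<^sup>2) * (q\<^sup>2) powi (int v - int u)
       * ?b (int n) * ?b (int u) * ?b (int v) * H (int n + int u + int v))"
  proof (rule sum.cong[OF refl], rule trans[OF sum.swap], intro sum.cong refl)
    fix n u v :: nat
    have p: "(q ^ 3) ^ k\<^sup>2 = (q ^ 3) powi ((int k)\<^sup>2)" for k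
      by (metis of_nat_power power_int_of_nat)
    have 1: "(q\<^sup>2) powi (int v - int u) = inverse (q\<^sup>2) ^ u * (q\<^sup>2) ^ v"
      using q0 by (simp add: power_int_diff divide_inverse power_inverse)
    have 2: "(q ^ 3) powi ((int n)\<^sup>2 + (int u)\<^sup>2 + (int v)\<^sup>2) = (q ^ 3) ^ n\<^sup>2 * (q ^ 3) ^ u\<^sup>2 * (q ^ 3) ^ v\<^sup>2"
      unfolding p using q0 by (simp add: power_int_add)
    show "(q ^ 3) ^ n\<^sup>2 * ?b (int n)
       * (inverse (q\<^sup>2) ^ u * (q ^ 3) ^ u\<^sup>2 * ?b (int u))
       * ((q\<^sup>2) ^ v * (q ^ 3) ^ v\<^sup>2 * ?b (int v)) * H (int (n + u + v)) =
       (q ^ 3) powi ((int n)\<^sup>2 + (int u)\<^sup>2 + (int v)\<^sup>2) * (q\<^sup>2) powi (int v - int u)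
       * ?b (int n) * ?b (int u) * ?b (int v) * H (int n + int u + int v)"
      unfolding 1 2 of_nat_add by (simp only: mult_ac)
  qed
  also have "\<dots> = (\<Sum>n\<in>{0..int M}. \<Sum>v\<in>{0..int M}. \<Sum>u\<in>{0..int M}. (q ^ 3) powi (n\<^sup>2 + u\<^sup>2 + v\<^sup>2) * (q\<^sup>2) powi (v - u)
       * ?b n * ?b u * ?b v * H (n + u + v))"
    by (simp only: sum_nat_le_int[symmetric])
  also have "\<dots> = (\<Sum>j\<in>{-J..J}. (q ^ 3) powi (j\<^sup>2) * (q\<^sup>2) powi j * refined_qtrinomial (q ^ 3) L (int M) j j)"
    unfolding H_def by (rule sum_trin_diagonal[OF assms(2), where z = "q\<^sup>2" and L = L, unfolded q6, symmetric])
  also have "\<dots> = cap_sum q J 0 L (int M)"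
    unfolding cap_sum_def
  proof (rule sum.cong)
    fix j
    have "(q ^ 3) powi (j\<^sup>2) * (q\<^sup>2) powi j = q powi (3 * j\<^sup>2 + 2 * j)"
      unfolding cube_powi using q0 by (simp add: power_int_add power_int_mult)
    thus "(q ^ 3) powi (j\<^sup>2) * (q\<^sup>2) powi j * refined_qtrinomial (q ^ 3) L (int M) j j
      = q powi (3 * (int 0 + 1) * j\<^sup>2 + 2 * j) * refined_qtrinomial (q ^ 3) L (int M) ((int 0 + 1) * j) j"
      by simp
  qed simp
  finally show ?thesis .
qed

text \<open>The bounds \<open>B\<close> and \<open>J\<close> stay fixed during the induction:
  passing from (L, M) to (L - i, i) with i \<le> M preserves L \<le> B and M \<le> J.\<close>

theorem sum_cap_term:
  assumes "L \<le> int B" "int M \<le> J"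
  shows "(\<Sum>m\<le>B. \<Sum>n\<in>{1..\<nu>} \<rightarrow>\<^sub>E {..B}. cap_term q \<nu> L (int M) m n) = cap_sum q J \<nu> L (int M)"
  using assms
proof (induction \<nu> arbitrary: L M)
  case 0
  thus ?case using seed_identity[of L B M J] by simp
next
  case (Suc \<nu>)
  show ?case
  proof (cases "L < 0")
    case True
    thus ?thesis by (simp add: cap_term_eq_0 cap_sum_def refined_qtrinomial_neg)
  next
    case False
    define f where "f = (\<lambda>i. q ^ (3 * i\<^sup>2) * qbinom (q ^ 6) (L + int M - int i) L)"
    \<comment> \<open>For fixed n' the variable n_1 = x is exchanged for i = N_1 = x + t. Terms with
      i > M, i < t or i > L vanish, and L \<le> B keeps i - t within the range of x.\<close>
    have inner: "(\<Sum>x\<le>B. cap_term q (Suc \<nu>) L (int M) m (\<lambda>k\<in>{1..Suc \<nu>}. if k = 1 then x else n' (k - 1)))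
       = (\<Sum>i\<le>M. f i * cap_term q \<nu> (L - int i) (int i) m n')" (is "sum ?g _ = sum ?h _") for m n'
    proof -
      let ?n = "\<lambda>x. \<lambda>k\<in>{1..Suc \<nu>}. if k = 1 then x else n' (k - 1)"
      define t where "t = tail_sum \<nu> n' 1"
      have ts: "tail_sum (Suc \<nu>) (?n x) 1 = x + t" for x
      proof -
        have "tail_sum (Suc \<nu>) (?n x) 1 = ?n x 1 + (\<Sum>i=Suc 1..Suc \<nu>. ?n x i)"
          unfolding tail_sum_def by (rule sum.atLeast_Suc_atMost) simp
        also have "(\<Sum>i=Suc 1..Suc \<nu>. ?n x i) = t"
          unfolding sum.shift_bounds_cl_Suc_ivl t_def tail_sum_def by (rule sum.cong) auto
        moreover have "?n x 1 = x" by simp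
        ultimately show ?thesis by (simp only:)
      qed
      have g: "?g x = ?h (x + t)" for x
      proof -
        have p: "n' k = ?n x (Suc k)" if "k \<in> {1..\<nu>}" for k using that by auto
        show ?thesis unfolding f_def by (simp only: cap_term_Suc[of \<nu> n' "?n x", OF p] ts)
      qed
      have h0: "?h i = 0" if "L < int i \<or> i < t \<or> M < i" for i
      proof -
        have "cap_term q \<nu> (L - int i) (int i) m n' = 0 \<or> f i = 0"
        proof (cases "M < i")
          case True
          thus ?thesis by (simp add: f_def qbinom_eq_0)
        next
          case False
          moreover have "t = 0" if "\<nu> = 0" using that by (simp add: t_def tail_sum_def)
          ultimately have "L - int i < 0 \<or> int i < int (tail_sum \<nu> n' 1) \<and> 0 < \<nu>"
            using that by (cases "\<nu> = 0") (auto simp: t_def)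
          thus ?thesis using cap_term_eq_0 by blast
        qed
        thus ?thesis by auto
      qed
      have "(\<Sum>x\<le>B. ?h (x + t)) = (\<Sum>i\<le>M. ?h i)"
      proof (rule sum.reindex_bij_witness_not_neutral[where S' = "{x \<in> {..B}. ?h (x + t) = 0}"
            and T' = "{i \<in> {..M}. ?h i = 0}" and i = "\<lambda>i. i - t" and j = "\<lambda>x. x + t"])
        fix x assume "x \<in> {..B} - {x \<in> {..B}. ?h (x + t) = 0}"
        hence nz: "?h (x + t) \<noteq> 0" by blast
        hence "x + t \<le> M" using h0[of "x + t"] by (meson not_le)
        thus "x + t \<in> {..M} - {i \<in> {..M}. ?h i = 0}" using nz by blast
      next
        fix i assume i: "i \<in> {..M} - {i \<in> {..M}. ?h i = 0}"
        hence nz: "?h i \<noteq> 0" by blast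
        hence "t \<le> i \<and> int i \<le> L" using h0[of i] by (meson not_le)
        moreover from this show "i - t + t = i" by simp
        ultimately show "i - t \<in> {..B} - {x \<in> {..B}. ?h (x + t) = 0}" using nz Suc.prems by auto
      qed auto
      thus ?thesis unfolding g .
    qed
    have "(\<Sum>m\<le>B. \<Sum>n\<in>{1..Suc \<nu>} \<rightarrow>\<^sub>E {..B}. cap_term q (Suc \<nu>) L (int M) m n)
      = (\<Sum>m\<le>B. \<Sum>n'\<in>{1..\<nu>} \<rightarrow>\<^sub>E {..B}. \<Sum>i\<le>M. f i * cap_term q \<nu> (L - int i) (int i) m n')"
      unfolding sum_PiE_Suc inner ..
    also have "\<dots> = (\<Sum>i\<le>M. \<Sum>m\<le>B. \<Sum>n'\<in>{1..\<nu>} \<rightarrow>\<^sub>E {..B}. f i * cap_term q \<nu> (L - int i) (int i) m n')"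
      by (rule trans[OF _ sum.swap], rule sum.cong[OF refl], rule sum.swap)
    also have "\<dots> = (\<Sum>i\<le>M. f i * cap_sum q J \<nu> (L - int i) (int i))"
      unfolding sum_distrib_left[symmetric] using Suc.prems by (intro sum.cong refl, subst Suc.IH) auto
    also have "\<dots> = cap_sum q J (Suc \<nu>) L (int M)"
      unfolding f_def by (rule cap_sum_Suc) (use False in simp)
    finally show ?thesis .
  qed
qed

end

text \<open>At \<open>q = 0\<close> the transformation with its negative powers of \<open>q\<close> is not available, but both
  sides collapse to a single term.\<close>

lemma qbinom_base_0: "qbinom 0 A m = (if 0 \<le> m \<and> m \<le> A then 1 else 0)"
  by (simp add: qbinom_def qpoch_def)

lemma sum_cap_term_base_0:
  assumes "1 \<le> \<nu>"
  shows "(\<Sum>m\<le>B. \<Sum>n\<in>{1..\<nu>} \<rightarrow>\<^sub>E {..B}. cap_term 0 \<nu> (int L) (int M) m n) = (if even L then 1 else 0)"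
proof -
  let ?n0 = "\<lambda>k\<in>{1..\<nu>}. 0 :: nat"
  let ?D = "{..B} \<times> ({1..\<nu>} \<rightarrow>\<^sub>E {..B})"
  have z: "cap_term 0 \<nu> (int L) (int M) m n = 0" if "n \<in> {1..\<nu>} \<rightarrow>\<^sub>E {..B}" "m \<noteq> 0 \<or> n \<noteq> ?n0" for m n
  proof -
    have "m\<^sup>2 + 3 * (\<Sum>k=1..\<nu>. (tail_sum \<nu> n k)\<^sup>2) \<noteq> 0"
    proof (cases "m = 0")
      case True
      with that have "n \<noteq> ?n0" by simp
      moreover have "n = ?n0" if all0: "\<forall>k\<in>{1..\<nu>}. n k = 0"
      proof
        fix k
        show "n k = ?n0 k"
          using all0 PiE_arb[OF \<open>n \<in> {1..\<nu>} \<rightarrow>\<^sub>E {..B}\<close>, of k] by (cases "k \<in> {1..\<nu>}") auto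
      qed
      ultimately obtain k where k: "k \<in> {1..\<nu>}" "n k \<noteq> 0" by blast
      hence "n k \<le> tail_sum \<nu> n k"
        unfolding tail_sum_def by (intro member_le_sum) auto
      hence "(tail_sum \<nu> n k)\<^sup>2 \<noteq> 0" using k by auto
      hence "(\<Sum>k=1..\<nu>. (tail_sum \<nu> n k)\<^sup>2) \<noteq> 0" using k by (subst sum_eq_0_iff) auto
      thus ?thesis by simp
    qed simp
    hence "(0 :: complex) ^ (m\<^sup>2 + 3 * (\<Sum>k=1..\<nu>. (tail_sum \<nu> n k)\<^sup>2)) = 0"
      by (simp only: power_0_left if_False)
    thus ?thesis using assms by (simp only: cap_term_def mult_zero_left if_cancel) simp
  qed
  have "(\<Sum>m\<le>B. \<Sum>n\<in>{1..\<nu>} \<rightarrow>\<^sub>E {..B}. cap_term 0 \<nu> (int L) (int M) m n)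
     = (\<Sum>(m, n)\<in>?D. cap_term 0 \<nu> (int L) (int M) m n)"
    by (rule sum.cartesian_product)
  also have "\<dots> = (\<Sum>(m, n)\<in>{(0, ?n0)}. cap_term 0 \<nu> (int L) (int M) m n)"
  proof (rule sum.mono_neutral_right)
    show "\<forall>x\<in>?D - {(0, ?n0)}. (case x of (m, n) \<Rightarrow> cap_term 0 \<nu> (int L) (int M) m n) = 0"
    proof
      fix x assume x: "x \<in> ?D - {(0, ?n0)}"
      obtain m n where mn: "x = (m, n)" by force
      have "cap_term 0 \<nu> (int L) (int M) m n = 0"
        by (rule z) (use x mn in auto)
      thus "(case x of (m, n) \<Rightarrow> cap_term 0 \<nu> (int L) (int M) m n) = 0" by (simp add: mn)
    qed
  qed (auto simp: finite_PiE)
  also have "\<dots> = (if even L then 1 else 0)"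
  proof -
    have ts: "tail_sum \<nu> ?n0 k = 0" if "1 \<le> k" for k
      unfolding tail_sum_def using that by (intro sum.neutral) auto
    have "?n0 \<nu> = 0" using assms by simp
    have s1: "(\<Sum>l=1..j. tail_sum \<nu> ?n0 l) = 0" and s2: "(\<Sum>l=1..j. (tail_sum \<nu> ?n0 l)\<^sup>2) = 0" for j
      by (intro sum.neutral; use ts in auto)+
    have pr: "(\<Prod>j=1..<\<nu>. qbinom (0 ^ 6) (int L - int (\<Sum>l=1..j. tail_sum \<nu> ?n0 l) + int (?n0 j)) (int (?n0 j))) = 1"
      by (rule prod.neutral) (auto simp: s1[unfolded One_nat_def] qbinom_base_0)
    have "tail_sum \<nu> ?n0 1 = 0" by (rule ts) simp
    hence "cap_term 0 \<nu> (int L) (int M) 0 ?n0 = (if even L then 1 else 0)"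
      using assms unfolding cap_term_def s1 s2 pr \<open>?n0 \<nu> = 0\<close> \<open>tail_sum \<nu> ?n0 1 = 0\<close>
      by (simp add: qbinom_base_0)
    thus ?thesis by (simp del: One_nat_def)
  qed
  finally show ?thesis .
qed

lemma cap_sum_base_0:
  assumes "int M \<le> J"
  shows "cap_sum 0 J \<nu> (int L) (int M) = (if even L then 1 else 0)"
proof -
  let ?f = "\<lambda>j. 0 powi (3 * (int \<nu> + 1) * j\<^sup>2 + 2 * j) * refined_qtrinomial (0 ^ 3) (int L) (int M) ((int \<nu> + 1) * j) j"
  have "?f j = 0" if "j \<noteq> 0" for j
  proof -
    \<comment> \<open>After division by j the exponent is congruent to 2 mod 3, so it vanishes only
      at j = 0; a power of 0 with nonzero integer exponent is 0.\<close>
    have "3 * (int \<nu> + 1) * j\<^sup>2 + 2 * j \<noteq> 0"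
    proof
      assume "3 * (int \<nu> + 1) * j\<^sup>2 + 2 * j = 0"
      hence "j * (3 * ((int \<nu> + 1) * j) + 2) = 0" by (simp add: power2_eq_square algebra_simps)
      hence "3 * ((int \<nu> + 1) * j) + 2 = 0" using that unfolding mult_eq_0_iff by blast
      thus False by presburger
    qed
    thus ?thesis by (simp add: power_int_0_left_if)
  qed
  hence "cap_sum 0 J \<nu> (int L) (int M) = (\<Sum>j\<in>{0}. ?f j)"
    unfolding cap_sum_def using assms by (intro sum.mono_neutral_right) auto
  also have "\<dots> = refined_qtrinomial 0 (int L) (int M) 0 0" by simp
  also have "\<dots> = (\<Sum>n\<in>{0..int M}. if n = 0 then (if even L then 1 else 0) else 0)"
    unfolding refined_qtrinomial_int[OF of_nat_0_le_iff]
    by (rule sum.cong) (auto simp: qbinom_base_0 power_int_0_left_if)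
  finally show ?thesis by simp
qed

section \<open>From finite to infinite sums\<close>

lemma has_sum_cap_sum:
  "((\<lambda>j. q powi (3 * (int \<nu> + 1) * j\<^sup>2 + 2 * j)
     * refined_qtrinomial (q ^ 3) L (int M) ((int \<nu> + 1) * j) j) has_sum cap_sum q (int M) \<nu> L (int M)) UNIV"
proof -
  have "refined_qtrinomial (q ^ 3) L (int M) a j = 0" if "j \<notin> {- int M..int M}" for a j
    unfolding refined_qtrinomial_int[OF of_nat_0_le_iff]
    by (intro sum.neutral) (use that in \<open>auto simp: qbinom_eq_0\<close>)
  thus ?thesis unfolding cap_sum_def
    by (intro has_sum_finite_neutralI) auto
qed

theorem theorem5p1:
  fixes q :: complex and \<nu> L M :: nat
  assumes "norm q < 1" and "\<nu> \<ge> 1"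
  defines "N \<equiv> tail_sum \<nu>"
  defines "S \<equiv> {(m :: nat, n :: nat \<Rightarrow> nat). n \<in> {1..\<nu>} \<rightarrow>\<^sub>E UNIV \<and>
                  [L + m = (\<Sum>k=1..\<nu>. N n k)] (mod 2)}"
  defines "lhs_term \<equiv> \<lambda>(m :: nat, n :: nat \<Rightarrow> nat).
             q ^ (m\<^sup>2 + 3 * (\<Sum>k=1..\<nu>. (N n k)\<^sup>2))
             * qbinom (q ^ 6) (int L + int M - int (N n 1)) (int L)
             * qbinom (q\<^sup>2) (3 * int (n \<nu>)) (int m)
             * qbinom (q ^ 6)
                 (2 * int (n \<nu>) + (int L - int m - int (\<Sum>k=1..\<nu>. N n k)) div 2)
                 (2 * int (n \<nu>))
             * (\<Prod>j=1..<\<nu>. qbinom (q ^ 6)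
                 (int L - int (\<Sum>l=1..j. N n l) + int (n j)) (int (n j)))"
  defines "rhs_term \<equiv> \<lambda>j :: int.
             q powi (3 * (int \<nu> + 1) * j\<^sup>2 + 2 * j)
             * refined_qtrinomial (q ^ 3) (int L) (int M) ((int \<nu> + 1) * j) j"
  shows "lhs_term summable_on S \<and> rhs_term summable_on UNIV \<and>
         (\<Sum>\<^sub>\<infinity>x\<in>S. lhs_term x) = (\<Sum>\<^sub>\<infinity>j\<in>UNIV. rhs_term j)"
proof -
  let ?g = "\<lambda>(m, n). cap_term q \<nu> (int L) (int M) m n"
  \<comment> \<open>This box contains every nonzero term: if m or some n_k exceeds L, then m + N_1 +
    ... + N_\<nu> > L, and the binomial with bottom 2n_\<nu> has a top below its bottom.\<close>
  let ?D = "{..L} \<times> ({1..\<nu>} \<rightarrow>\<^sub>E {..L})"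
  have par: "[L + m = X] (mod 2) \<longleftrightarrow> even (int L - int m - int X)" for m X :: nat
    by (simp add: cong_def) presburger
  have nz: "(\<nu> = 0) = False" using assms(2) by simp
  have fg: "lhs_term x = ?g x" if "x \<in> S" for x
  proof -
    obtain m n where x: "x = (m, n)" by force
    have "even (int L - int m - int (\<Sum>k=1..\<nu>. tail_sum \<nu> n k))"
      using that unfolding S_def x N_def par by (simp only: mem_Collect_eq prod.case)
    thus ?thesis using nz unfolding x lhs_term_def cap_term_def N_def prod.case
      by (simp only: if_True if_False)
  qed
  have outside: "lhs_term x = 0" if "x \<in> S - ?D" for x
  proof -
    obtain m n where x: "x = (m, n)" by force
    define X where "X = (\<Sum>k=1..\<nu>. N n k)"
    have "L < m + X"
    proof (cases "m \<le> L")
      case True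
      with that x obtain k where k: "k \<in> {1..\<nu>}" "L < n k"
        by (auto simp: S_def PiE_iff not_le)
      have "n k \<le> N n k" unfolding N_def tail_sum_def using k by (intro member_le_sum) auto
      also have "N n k \<le> X" unfolding X_def using k by (intro member_le_sum) auto
      finally show ?thesis using k by simp
    qed simp
    hence "(int L - int m - int X) div 2 < 0" by simp
    hence "qbinom (q ^ 6) (2 * int (n \<nu>) + (int L - int m - int X) div 2) (2 * int (n \<nu>)) = 0"
      by (intro qbinom_eq_0) simp
    thus ?thesis unfolding lhs_term_def x X_def by simp
  qed
  have inside: "?g x = 0" if "x \<in> ?D - S" for x
  proof -
    obtain m n where x: "x = (m, n)" by force
    have "n \<in> {1..\<nu>} \<rightarrow>\<^sub>E UNIV" using that unfolding x by (auto simp: PiE_iff)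
    hence "odd (int L - int m - int (\<Sum>k=1..\<nu>. tail_sum \<nu> n k))"
      using that unfolding S_def x N_def par by (simp only: mem_Collect_eq prod.case Diff_iff) blast
    thus ?thesis using nz unfolding x cap_term_def prod.case by (simp only: if_False)
  qed
  have total: "(\<Sum>x\<in>?D. ?g x) = cap_sum q (int M) \<nu> (int L) (int M)"
  proof (cases "q = 0")
    case True
    thus ?thesis
      using sum_cap_term_base_0[OF assms(2), where B = L and L = L and M = M] cap_sum_base_0[of M "int M" \<nu> L]
      by (simp add: sum.cartesian_product)
  next
    case False
    thus ?thesis using sum_cap_term[OF False assms(1), of "int L" L M "int M" \<nu>]
      by (simp add: sum.cartesian_product)
  qed
  have "(?g has_sum (\<Sum>x\<in>?D. ?g x)) ?D"
    by (rule has_sum_finite) (auto simp: finite_PiE)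
  hence lhs: "(lhs_term has_sum cap_sum q (int M) \<nu> (int L) (int M)) S"
    unfolding total using has_sum_cong_neutral[of ?D S ?g lhs_term] fg outside inside by blast
  have rhs: "(rhs_term has_sum cap_sum q (int M) \<nu> (int L) (int M)) UNIV"
    unfolding rhs_term_def by (rule has_sum_cap_sum)
  show ?thesis using lhs rhs by (auto simp: infsumI dest: has_sum_imp_summable)
qed

end
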